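(* Let $0<\alpha_1,\alpha_2<\pi/2$, let $f\in Exp(\alpha_1,\alpha_2)$, and let $A_1^+,A_2^+,A_1^-,A_2^-$ be real numbers satisfying $$(A_1^+,A_2^+)\in\overline{T}_f(\alpha_1,\alpha_2),\qquad (A_1^-,A_2^-)\in\overline{T}_f(-\alpha_1,-\alpha_2),$$ $$(A_1^+,A_2^-)\in\overline{T}_f(\alpha_1,-\alpha_2),\qquad (A_1^-,A_2^+)\in\overline{T}_f(-\alpha_1,\alpha_2).$$ Let $\theta_1,\theta_2$ be real numbers with $|\theta_1|<\alpha_1$ and $|\theta_2|<\alpha_2$. Then $$(C_1,C_2)\in\overline{T}_f(\theta_1,\theta_2),$$ where the constants $C_1,C_2$ are determined by $$C_1\sin(2\alpha_1)=A_1^+\sin(\theta_1+\alpha_1)+A_1^-\sin(\alpha_1-\theta_1),$$ $$C_2\sin(2\alpha_2)=A_2^+\sin(\theta_2+\alpha_2)+A_2^-\sin(\alpha_2-\theta_2).$$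
   Context: For $0<\alpha<\pi/2$ let $\Delta_{\alpha}=\{z\in\mathbb{C}\setminus\{0\}:|\arg z|<\alpha\}$ be the open sector. A function $f$ on $\Delta_{\alpha_1}\times\Delta_{\alpha_2}$ is of finite exponential type $(h_1,h_2)$, where $h_1,h_2\ge 0$, if for every $\varepsilon>0$ there is a constant $k_\varepsilon\ge 0$ with $|f(z_1,z_2)|\le k_\varepsilon e^{(h_1+\varepsilon)|z_1|+(h_2+\varepsilon)|z_2|}$ for all $z_1\in\Delta_{\alpha_1}$, $z_2\in\Delta_{\alpha_2}$. $Exp(\alpha_1,\alpha_2)$ denotes the class of functions that are analytic and of finite exponential type (for some $(h_1,h_2)$) in $\Delta_{\alpha_1}\times\Delta_{\alpha_2}$. For $f\in Exp(\alpha_1,\alpha_2)$ and $\vec\theta=(\theta_1,\theta_2)$, the multidimensional indicator set after Ivanov is $$T_f(\theta_1,\theta_2)=\{(\nu_1,\nu_2)\in\mathbb{R}^2:\ \exists\, C_{\vec\nu,\vec\theta}\in\mathbb{R}\ \text{such that}\ \ln|f(r_1e^{i\theta_1},r_2e^{i\theta_2})|\le\nu_1r_1+\nu_2r_2+C_{\vec\nu,\vec\theta}\ \text{for all } r_1,r_2>0\},$$ and $\overline{T}_f(\theta_1,\theta_2)$ is its closure in $\mathbb{R}^2$. When $\theta_1=\pm\alpha_1$ and $\theta_2=\pm\alpha_2$, the value of $f$ on the corresponding boundary rays means the non-tangential limit of $f$ from inside $\Delta_{\alpha_1}\times\Delta_{\alpha_2}$; it exists for almost every $(r_1,r_2)$,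 and the inequality in the definition of $T_f$ is then required at almost every $(r_1,r_2)$. *)

theory Defs
  imports "HOL-Analysis.Analysis"
begin

definition sector :: "real \<Rightarrow> complex set" where
  "sector \<alpha> = {z. z \<noteq> 0 \<and> \<bar>Arg z\<bar> < \<alpha>}"

text \<open>
  Analyticity in two complex variables on an open set: the Frechet derivative exists at every
  point and is complex linear. Functions are total; the values outside \<open>S\<close> play no role.
\<close>

definition analytic2_on :: "(complex \<times> complex \<Rightarrow> complex) \<Rightarrow> (complex \<times> complex) set \<Rightarrow> bool" where
  "analytic2_on f S \<longleftrightarrow>
     (\<forall>z\<in>S. \<exists>a b. (f has_derivative (\<lambda>(u, v). a * u + b * v)) (at z))"

definition finite_exp_type ::
    "real \<Rightarrow> real \<Rightarrow> real \<Rightarrow> real \<Rightarrow> (complex \<times> complex \<Rightarrow> complex) \<Rightarrow> bool" where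
  "finite_exp_type \<alpha>\<^sub>1 \<alpha>\<^sub>2 h\<^sub>1 h\<^sub>2 f \<longleftrightarrow> 0 \<le> h\<^sub>1 \<and> 0 \<le> h\<^sub>2 \<and>
     (\<forall>\<epsilon>>0. \<exists>k\<ge>0. \<forall>z\<^sub>1\<in>sector \<alpha>\<^sub>1. \<forall>z\<^sub>2\<in>sector \<alpha>\<^sub>2.
        norm (f (z\<^sub>1, z\<^sub>2)) \<le> k * exp ((h\<^sub>1 + \<epsilon>) * norm z\<^sub>1 + (h\<^sub>2 + \<epsilon>) * norm z\<^sub>2))"

definition Exp_class :: "real \<Rightarrow> real \<Rightarrow> (complex \<times> complex \<Rightarrow> complex) set" where
  "Exp_class \<alpha>\<^sub>1 \<alpha>\<^sub>2 =
     {f. analytic2_on f (sector \<alpha>\<^sub>1 \<times> sector \<alpha>\<^sub>2) \<and> (\<exists>h\<^sub>1 h\<^sub>2. finite_exp_type \<alpha>\<^sub>1 \<alpha>\<^sub>2 h\<^sub>1 h\<^sub>2 f)}"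

text \<open>\<open>ln |w|\<close> with the convention \<open>ln 0 = -\<infinity>\<close> (whereas \<open>ln (0::real) = 0\<close> in the library).\<close>

definition ln_norm :: "complex \<Rightarrow> ereal" where
  "ln_norm w = (if w = 0 then -\<infinity> else ereal (ln (norm w)))"

text \<open>
  Stolz region of aperture \<open>\<kappa>\<close> at \<open>\<zeta>\<close>. A non-tangential limit is a limit along the products of
  these regions, for every aperture. If \<open>\<zeta>\<close> lies inside the sector, the region contains a
  neighbourhood of \<open>\<zeta>\<close>, so the approach in that variable is unrestricted.
\<close>

definition nontangential_region :: "real \<Rightarrow> real \<Rightarrow> complex \<Rightarrow> complex set" where
  "nontangential_region \<alpha> \<kappa> \<zeta> = {z \<in> sector \<alpha>. dist z \<zeta> < \<kappa> * infdist z (frontier (sector \<alpha>))}"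

definition has_nontangential_limit ::
    "real \<Rightarrow> real \<Rightarrow> (complex \<times> complex \<Rightarrow> complex) \<Rightarrow> complex \<Rightarrow> complex \<Rightarrow> complex \<Rightarrow> bool" where
  "has_nontangential_limit \<alpha>\<^sub>1 \<alpha>\<^sub>2 f \<zeta>\<^sub>1 \<zeta>\<^sub>2 L \<longleftrightarrow>
     (\<forall>\<kappa>>1. (f \<longlongrightarrow> L) (at (\<zeta>\<^sub>1, \<zeta>\<^sub>2) within
                nontangential_region \<alpha>\<^sub>1 \<kappa> \<zeta>\<^sub>1 \<times> nontangential_region \<alpha>\<^sub>2 \<kappa> \<zeta>\<^sub>2))"

text \<open>
  The set \<open>T\<^sub>f(\<theta>\<^sub>1, \<theta>\<^sub>2)\<close>, for \<open>|\<theta>\<^sub>j| \<le> \<alpha>\<^sub>j\<close>. On boundary rays, for almost every \<open>(r\<^sub>1, r\<^sub>2)\<close> the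
  non-tangential limit exists and satisfies the inequality; existence almost everywhere is
  automatic for functions in \<open>Exp_class \<alpha>\<^sub>1 \<alpha>\<^sub>2\<close> when \<open>0 < \<alpha>\<^sub>j < \<pi>/2\<close>.
\<close>

definition indicator_set ::
    "real \<Rightarrow> real \<Rightarrow> (complex \<times> complex \<Rightarrow> complex) \<Rightarrow> real \<Rightarrow> real \<Rightarrow> (real \<times> real) set" where
  "indicator_set \<alpha>\<^sub>1 \<alpha>\<^sub>2 f \<theta>\<^sub>1 \<theta>\<^sub>2 =
     {(\<nu>\<^sub>1, \<nu>\<^sub>2). \<exists>C::real.
        if \<bar>\<theta>\<^sub>1\<bar> < \<alpha>\<^sub>1 \<and> \<bar>\<theta>\<^sub>2\<bar> < \<alpha>\<^sub>2 then
          \<forall>r\<^sub>1>0. \<forall>r\<^sub>2>0. ln_norm (f (rcis r\<^sub>1 \<theta>\<^sub>1, rcis r\<^sub>2 \<theta>\<^sub>2)) \<le> ereal (\<nu>\<^sub>1 * r\<^sub>1 + \<nu>\<^sub>2 * r\<^sub>2 + C)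
        else
          AE r in (lborel :: (real \<times> real) measure). 0 < fst r \<longrightarrow> 0 < snd r \<longrightarrow>
            (\<exists>L. has_nontangential_limit \<alpha>\<^sub>1 \<alpha>\<^sub>2 f (rcis (fst r) \<theta>\<^sub>1) (rcis (snd r) \<theta>\<^sub>2) L \<and>
                 ln_norm L \<le> ereal (\<nu>\<^sub>1 * fst r + \<nu>\<^sub>2 * snd r + C))}"

end

theory Submission
  imports Defs "HOL-Complex_Analysis.Complex_Analysis"
begin

text \<open>
  Choose complex numbers \<open>a\<^sub>1, a\<^sub>2\<close> such that the real part of \<open>a\<^sub>j z\<^sub>j\<close> has slope \<open>A\<^sub>j\<^sup>\<plusminus>\<close> (up to a small
  \<open>\<epsilon>\<close>) along the two boundary rays; its slope along the ray \<open>\<theta>\<^sub>j\<close> is then \<open>C\<^sub>j\<close>. Dividing \<open>f\<close> by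
  \<open>exp (a\<^sub>1 z\<^sub>1 + a\<^sub>2 z\<^sub>2)\<close> makes its boundary values bounded by a constant \<open>M\<close>, and a Phragmen-Lindelof
  argument is needed to carry the bound inside. The factors \<open>exp (- \<delta> z\<^sub>j\<^sup>p)\<close> with \<open>p > 1\<close> and
  \<open>p \<alpha>\<^sub>j < \<pi> / 2\<close> make the function \<open>F\<close> bounded and small at infinity.

  For such an \<open>F\<close>, apply Cauchy's formula in each variable to the powers of the translates
  \<open>F (z\<^sub>1 + t, z\<^sub>2 + t)\<close>, on triangles with a vertex at the origin, two sides on the boundary rays and
  the third side far away. The translates are holomorphic up to the boundary and converge to the
  non-tangential limits as \<open>t\<close> tends to 0, so Fatou's lemma for upper limits gives \<open>|F|\<^sup>n \<le> K M\<^sup>n\<close> with \<open>K\<close>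
  independent of \<open>n\<close>, hence \<open>|F| \<le> M\<close>. Finally \<open>\<delta>\<close> and \<open>\<epsilon>\<close> tend to 0.
\<close>

subsection \<open>Cauchy's formula on triangles in a sector\<close>

text \<open>On the segment the Cauchy kernel is at most \<open>1 / d\<close>, and the
  parametrisation contributes the factor \<open>norm (b - a)\<close>. The right-hand side is a
  nonnegative integral, ready for Tonelli's theorem and Fatou's lemma. The endpoints are removed as
  a null set, because the vertices of the later triangles do not count as points of the open
  boundary rays.\<close>

lemma norm_contour_integral_linepath_le:
  fixes \<phi> :: "complex \<Rightarrow> complex"
  assumes cont: "continuous_on (closed_segment a b) \<phi>" and "0 < d"
    and d: "\<And>z. z \<in> closed_segment a b \<Longrightarrow> d \<le> norm (z - w)"
  shows "ennreal (norm (contour_integral (linepath a b) (\<lambda>z. \<phi> z / (z - w)))) \<le>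
    ennreal (norm (b - a) / d) *
      (\<integral>\<^sup>+x. ennreal (norm (\<phi> (linepath a b x))) * indicator {0<..<1} x \<partial>lborel)"
proof -
  let ?l = "linepath a b" and ?K = "norm (b - a) / d"
  have mem: "?l x \<in> closed_segment a b" if "x \<in> {0..1}" for x
    using that linepath_in_path by blast
  have contl: "continuous_on {0..1} ?l"
    using path_def path_linepath by blast
  have c1: "continuous_on {0..1} (\<lambda>x. \<phi> (?l x))"
    by (rule continuous_on_compose2[OF cont contl]) (use mem in auto)
  have c2: "continuous_on {0..1} (\<lambda>x. \<phi> (?l x) / (?l x - w) * (b - a))"
    using mem d \<open>0 < d\<close> by (intro continuous_intros c1 contl) force
  have c3: "continuous_on {0..1} (\<lambda>x. ?K * norm (\<phi> (?l x)))"
    by (intro continuous_intros c1)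
  have bnd: "norm (\<phi> (?l x) / (?l x - w) * (b - a)) \<le> ?K * norm (\<phi> (?l x))"
    if x: "x \<in> {0..1}" for x
  proof -
    have "norm (\<phi> (?l x) / (?l x - w)) \<le> norm (\<phi> (?l x)) / d"
      using d[OF mem[OF x]] \<open>0 < d\<close> by (auto simp: norm_divide intro!: divide_left_mono mult_pos_pos)
    from mult_right_mono[OF this norm_ge_zero[of "b - a"]] show ?thesis
      by (simp add: norm_mult norm_divide mult_ac)
  qed
  have int3: "((\<lambda>x. ?K * norm (\<phi> (?l x))) has_integral
      integral {0..1} (\<lambda>x. ?K * norm (\<phi> (?l x)))) {0..1}"
    using integrable_continuous_real[OF c3] by (rule integrable_integral)
  have meas: "(\<lambda>x. ennreal (norm (\<phi> (?l x))) * indicator {0<..<1} x) \<in> borel_measurable lborel"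
  proof -
    have "(\<lambda>x. indicator {0<..<1} x *\<^sub>R \<phi> (?l x)) \<in> borel_measurable borel"
      by (rule borel_measurable_continuous_on_indicator)
        (auto intro: continuous_on_subset[OF c1])
    then have "(\<lambda>x. ennreal (norm (indicator {0<..<1} x *\<^sub>R \<phi> (?l x)))) \<in> borel_measurable lborel"
      by measurable
    also have "(\<lambda>x. ennreal (norm (indicator {0<..<1} x *\<^sub>R \<phi> (?l x)))) =
        (\<lambda>x. ennreal (norm (\<phi> (?l x))) * indicator {0<..<1} x)"
      by (auto simp: fun_eq_iff indicator_def)
    finally show ?thesis .
  qed
  have "norm (contour_integral ?l (\<lambda>z. \<phi> z / (z - w))) =
      norm (integral {0..1} (\<lambda>x. \<phi> (?l x) / (?l x - w) * (b - a)))"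
    by (simp add: contour_integral_integral)
  also have "\<dots> \<le> integral {0..1} (\<lambda>x. ?K * norm (\<phi> (?l x)))"
    by (rule integral_norm_bound_integral)
      (use integrable_continuous_real c2 c3 bnd in auto)
  finally have "ennreal (norm (contour_integral ?l (\<lambda>z. \<phi> z / (z - w)))) \<le>
      ennreal (integral {0..1} (\<lambda>x. ?K * norm (\<phi> (?l x))))"
    by (rule ennreal_leI)
  also have "\<dots> = (\<integral>\<^sup>+x. ennreal (?K * norm (\<phi> (?l x))) * indicator {0..1} x \<partial>lborel)"
    by (rule nn_integral_has_integral_lebesgue'[symmetric]) (use int3 \<open>0 < d\<close> in auto)
  also have "\<dots> = (\<integral>\<^sup>+x. ennreal ?K * (ennreal (norm (\<phi> (?l x))) * indicator {0<..<1} x) \<partial>lborel)"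
    using AE_lborel_singleton[of 0] AE_lborel_singleton[of 1]
    by (intro nn_integral_cong_AE, eventually_elim)
      (use \<open>0 < d\<close> in \<open>auto simp: indicator_def simp flip: ennreal_mult\<close>)
  also have "\<dots> = ennreal ?K *
      (\<integral>\<^sup>+x. ennreal (norm (\<phi> (?l x))) * indicator {0<..<1} x \<partial>lborel)"
    by (rule nn_integral_cmult[OF meas])
  finally show ?thesis .
qed


text \<open>Cauchy's integral formula along the boundary of the triangle, estimated side by side.
  The constant \<open>K\<close> depends on the triangle and on \<open>w\<close> alone, not on
  \<open>S\<close> or \<open>\<phi>\<close>; this uniformity later allows \<open>\<phi>\<close> to
  be replaced by its powers and translates.\<close>

lemma Cauchy_triangle_norm_le:
  fixes a b c w :: complex
  assumes w: "w \<in> interior (convex hull {a, b, c})"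
  obtains K where "0 \<le> K"
    "\<And>S \<phi>. open S \<Longrightarrow> convex S \<Longrightarrow> {a, b, c} \<subseteq> S \<Longrightarrow> \<phi> holomorphic_on S \<Longrightarrow>
       ennreal (norm (\<phi> w)) \<le> ennreal K *
         ((\<integral>\<^sup>+x. ennreal (norm (\<phi> (linepath a b x))) * indicator {0<..<1} x \<partial>lborel)
        + (\<integral>\<^sup>+x. ennreal (norm (\<phi> (linepath b c x))) * indicator {0<..<1} x \<partial>lborel)
        + (\<integral>\<^sup>+x. ennreal (norm (\<phi> (linepath c a x))) * indicator {0<..<1} x \<partial>lborel))"
proof -
  define T where "T = closed_segment a b \<union> closed_segment b c \<union> closed_segment c a"
  have wT: "w \<notin> T"
    using w interior_of_triangle[of a b c] by (auto simp: T_def)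
  have "closed T"
    unfolding T_def by (intro closed_Un closed_segment)
  then obtain d where "0 < d" and d: "\<And>z. z \<in> T \<Longrightarrow> d \<le> norm (z - w)"
    using separate_point_closed[OF \<open>closed T\<close> wT] by (auto simp: dist_norm norm_minus_commute)
  define K where "K = norm (b - a) / d + norm (c - b) / d + norm (a - c) / d"
  show thesis
  proof
    show "0 \<le> K" using \<open>0 < d\<close> by (simp add: K_def)
  next
    fix S :: "complex set" and \<phi> :: "complex \<Rightarrow> complex"
    assume S: "open S" "convex S" "{a, b, c} \<subseteq> S" and hol: "\<phi> holomorphic_on S"
    let ?\<psi> = "\<lambda>z. \<phi> z / (z - w)"
    let ?\<gamma> = "linepath a b +++ linepath b c +++ linepath c a"
    let ?I = "\<lambda>p q. \<integral>\<^sup>+x. ennreal (norm (\<phi> (linepath p q x))) * indicator {0<..<1} x \<partial>lborel"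
    let ?c = "\<lambda>p q. contour_integral (linepath p q) ?\<psi>"
    have hull: "convex hull {a, b, c} \<subseteq> S"
      using S by (simp add: subset_hull)
    have TS: "T \<subseteq> S"
      using S unfolding T_def by (auto dest: closed_segment_subset)
    have cT: "continuous_on T \<phi>"
      using holomorphic_on_imp_continuous_on[OF hol] TS continuous_on_subset by blast
    have bnd: "ennreal (norm (?c p q)) \<le> ennreal (norm (q - p) / d) * ?I p q"
      and int: "?\<psi> contour_integrable_on linepath p q"
      if pq: "closed_segment p q \<subseteq> T" for p q
    proof -
      show "ennreal (norm (?c p q)) \<le> ennreal (norm (q - p) / d) * ?I p q"
        by (rule norm_contour_integral_linepath_le)
          (use pq d \<open>0 < d\<close> in \<open>auto intro: continuous_on_subset[OF cT]\<close>)
      show "?\<psi> contour_integrable_on linepath p q"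
        by (rule contour_integrable_continuous_linepath)
          (use pq wT in \<open>auto intro!: continuous_intros continuous_on_subset[OF cT]\<close>)
    qed
    have sub: "closed_segment a b \<subseteq> T" "closed_segment b c \<subseteq> T" "closed_segment c a \<subseteq> T"
      by (auto simp: T_def)
    have "(?\<psi> has_contour_integral (2 * pi * \<i> * winding_number ?\<gamma> w * \<phi> w)) ?\<gamma>"
    proof (rule Cauchy_integral_formula_convex_simple[OF \<open>convex S\<close> hol])
      show "w \<in> interior S"
        using w interior_mono[OF hull] by auto
      show "path_image ?\<gamma> \<subseteq> S - {w}"
        using TS wT by (auto simp: T_def path_image_join)
    qed auto
    then have "2 * pi * \<i> * winding_number ?\<gamma> w * \<phi> w = ?c a b + (?c b c + ?c c a)"
      using contour_integral_unique sub by (fastforce simp: int)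
    then have "norm (2 * pi * \<i> * winding_number ?\<gamma> w * \<phi> w) = norm (?c a b + (?c b c + ?c c a))"
      by simp
    \<comment> \<open>The winding number is 1 or -1 according to the orientation of the triangle;
      taking norms makes the two cases agree.\<close>
    moreover have "norm (2 * pi * \<i> * winding_number ?\<gamma> w * \<phi> w) = 2 * pi * norm (\<phi> w)"
      by (subst winding_number_triangle[OF w]) (simp add: norm_mult)
    moreover have "1 * norm (\<phi> w) \<le> 2 * pi * norm (\<phi> w)"
      using pi_ge_two by (intro mult_right_mono) auto
    ultimately have "norm (\<phi> w) \<le> norm (?c a b) + norm (?c b c) + norm (?c c a)"
      using norm_triangle_ineq[of "?c a b" "?c b c + ?c c a"] norm_triangle_ineq[of "?c b c" "?c c a"]
      by linarith
    then have "ennreal (norm (\<phi> w)) \<le>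
        ennreal (norm (?c a b)) + ennreal (norm (?c b c)) + ennreal (norm (?c c a))"
      by (simp flip: ennreal_plus)
    also have "\<dots> \<le> ennreal K * ?I a b + ennreal K * ?I b c + ennreal K * ?I c a"
    proof (intro add_mono)
      have *: "ennreal (norm (?c p q)) \<le> ennreal K * ?I p q"
        if "closed_segment p q \<subseteq> T" "norm (q - p) / d \<le> K" for p q
        using bnd[OF that(1)] that(2) by (meson ennreal_leI mult_right_mono order_trans zero_le)
      show "ennreal (norm (?c a b)) \<le> ennreal K * ?I a b"
        "ennreal (norm (?c b c)) \<le> ennreal K * ?I b c"
        "ennreal (norm (?c c a)) \<le> ennreal K * ?I c a"
        by (intro * sub; use \<open>0 < d\<close> in \<open>simp add: K_def\<close>)+
    qed
    also have "\<dots> = ennreal K * (?I a b + ?I b c + ?I c a)"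
      by (simp add: distrib_left)
    finally show "ennreal (norm (\<phi> w)) \<le> ennreal K * (?I a b + ?I b c + ?I c a)" .
  qed
qed

section \<open>Geometry of sectors\<close>

text \<open>For \<open>z\<close> of modulus r and argument t the linear inequality says that r
  sin(\<alpha> + t) and r sin(\<alpha> - t) are both positive. Conversely it forces
  \<open>Re z > 0\<close>, so t lies between -pi/2 and pi/2, and the signs of the two sines then
  give |t| < \<alpha>. The sector thereby becomes an intersection of two half-planes.\<close>

lemma sector_altdef:
  assumes "0 < \<alpha>" "\<alpha> < pi / 2"
  shows "sector \<alpha> = {z. cos \<alpha> * \<bar>Im z\<bar> < sin \<alpha> * Re z}"
proof (intro equalityI subsetI)
  fix z assume "z \<in> sector \<alpha>"
  then have z: "z \<noteq> 0" "\<bar>Arg z\<bar> < \<alpha>" by (auto simp: sector_def)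
  have "0 < sin (\<alpha> + Arg z)" "0 < sin (\<alpha> - Arg z)"
    using z assms by (auto intro!: sin_gt_zero)
  then have "0 < norm z * sin (\<alpha> + Arg z)" "0 < norm z * sin (\<alpha> - Arg z)"
    using z by auto
  moreover have "Re z = norm z * cos (Arg z)" "Im z = norm z * sin (Arg z)"
    using rcis_cmod_Arg[of z] by (metis Re_rcis, metis Im_rcis)
  ultimately show "z \<in> {z. cos \<alpha> * \<bar>Im z\<bar> < sin \<alpha> * Re z}"
    by (auto simp: sin_add sin_diff abs_if algebra_simps)
next
  fix z assume z: "z \<in> {z. cos \<alpha> * \<bar>Im z\<bar> < sin \<alpha> * Re z}"
  have pos: "0 < cos \<alpha>" "0 < sin \<alpha>"
    using assms by (auto intro!: cos_gt_zero sin_gt_zero)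
  have "0 < sin \<alpha> * Re z"
    using z pos by (smt (verit) mem_Collect_eq mult_nonneg_nonneg abs_ge_zero)
  then have "0 < Re z" using pos by (simp add: zero_less_mult_iff)
  then have "z \<noteq> 0" and A: "\<bar>Arg z\<bar> < pi / 2"
    using Arg_Re_pos by auto
  have e: "Re z = norm z * cos (Arg z)" "Im z = norm z * sin (Arg z)"
    using rcis_cmod_Arg[of z] by (metis Re_rcis, metis Im_rcis)
  have "cos \<alpha> * Im z \<le> cos \<alpha> * \<bar>Im z\<bar>" "cos \<alpha> * (- Im z) \<le> cos \<alpha> * \<bar>Im z\<bar>"
    using pos by (intro mult_left_mono; simp)+
  then have "cos \<alpha> * Im z < sin \<alpha> * Re z" "cos \<alpha> * (- Im z) < sin \<alpha> * Re z"
    using z by auto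
  then have "0 < norm z * sin (\<alpha> + Arg z)" "0 < norm z * sin (\<alpha> - Arg z)"
    by (auto simp: sin_add sin_diff e algebra_simps)
  then have "0 < sin (\<alpha> + Arg z)" "0 < sin (\<alpha> - Arg z)"
    by (auto simp: zero_less_mult_iff)
  moreover have "sin x \<le> 0" if "x \<le> 0" "- pi \<le> x" for x :: real
    using that sin_ge_zero[of "- x"] by simp
  then have "\<alpha> + Arg z \<le> 0 \<Longrightarrow> sin (\<alpha> + Arg z) \<le> 0"
    and "\<alpha> - Arg z \<le> 0 \<Longrightarrow> sin (\<alpha> - Arg z) \<le> 0"
    using A assms by auto
  ultimately show "z \<in> sector \<alpha>"
    using \<open>z \<noteq> 0\<close> unfolding sector_def by fastforce
qed

text \<open>The half-plane form avoids \<open>Arg\<close>, so the vertex 0 belongs to the set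
  without a special case.\<close>

definition closed_sector :: "real \<Rightarrow> complex set" where
  "closed_sector \<alpha> = {z. cos \<alpha> * \<bar>Im z\<bar> \<le> sin \<alpha> * Re z}"

text \<open>The Cauchy-Schwarz inequality for the unit vector with entries cos \<alpha> and -sin
  \<alpha>, obtained from the identity that adds the square of the orthogonal component. It bounds
  how far a perturbation \<open>u\<close> can move a point towards the boundary lines.\<close>

lemma abs_Im_sector_form_le:
  "cos \<alpha> * \<bar>Im u\<bar> - sin \<alpha> * Re u \<le> norm u"
proof -
  have "(cos \<alpha> * \<bar>Im u\<bar> - sin \<alpha> * Re u)\<^sup>2 + (sin \<alpha> * \<bar>Im u\<bar> + cos \<alpha> * Re u)\<^sup>2
      = ((sin \<alpha>)\<^sup>2 + (cos \<alpha>)\<^sup>2) * (\<bar>Im u\<bar>\<^sup>2 + (Re u)\<^sup>2)"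
    by (simp only: power2_eq_square) algebra
  also have "\<dots> = (norm u)\<^sup>2"
    by (simp add: cmod_power2)
  finally have "(cos \<alpha> * \<bar>Im u\<bar> - sin \<alpha> * Re u)\<^sup>2 \<le> (norm u)\<^sup>2"
    by (smt (verit) zero_le_power2)
  then show ?thesis
    by (rule power2_le_imp_le) simp
qed

context
  fixes \<alpha> :: real
  assumes \<alpha>: "0 < \<alpha>" "\<alpha> < pi / 2"
begin

lemma sin_cos_pos: "0 < sin \<alpha>" "0 < cos \<alpha>"
  using \<alpha> by (auto intro!: cos_gt_zero sin_gt_zero)

lemma open_sector: "open (sector \<alpha>)"
  unfolding sector_altdef[OF \<alpha>] by (intro open_Collect_less continuous_intros)

lemma convex_sector: "convex (sector \<alpha>)"
proof -
  have "cos \<alpha> * \<bar>x\<bar> = \<bar>cos \<alpha> * x\<bar>" for x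
    using sin_cos_pos by (simp add: abs_mult)
  then have "sector \<alpha> = {z. inner (Complex (- sin \<alpha>) (cos \<alpha>)) z < 0} \<inter> {z. inner (Complex (- sin \<alpha>) (- cos \<alpha>)) z < 0}"
    by (auto simp: sector_altdef[OF \<alpha>] inner_complex_def abs_less_iff)
  then show ?thesis
    by (metis convex_Int convex_halfspace_lt)
qed

text \<open>Both sets are convex cones, and adding the strict inequality for \<open>u\<close> to the
  weak one for \<open>z\<close> gives a strict one. With \<open>u\<close> a positive real number
  this pushes boundary points into the open sector.\<close>

lemma closed_sector_add:
  assumes "z \<in> closed_sector \<alpha>" "u \<in> sector \<alpha>"
  shows "z + u \<in> sector \<alpha>"
proof -
  have "cos \<alpha> * \<bar>Im (z + u)\<bar> \<le> cos \<alpha> * (\<bar>Im z\<bar> + \<bar>Im u\<bar>)"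
    using sin_cos_pos by (intro mult_left_mono) auto
  then show ?thesis
    using assms by (auto simp: closed_sector_def sector_altdef[OF \<alpha>] algebra_simps)
qed

lemma of_real_in_sector: "0 < t \<Longrightarrow> of_real t \<in> sector \<alpha>"
  using sin_cos_pos by (simp add: sector_altdef[OF \<alpha>])

lemma sector_subset_closed_sector: "sector \<alpha> \<subseteq> closed_sector \<alpha>"
  by (auto simp: closed_sector_def sector_altdef[OF \<alpha>])

lemma Re_sector_pos: "z \<in> sector \<alpha> \<Longrightarrow> 0 < Re z"
  using sin_cos_pos unfolding sector_altdef[OF \<alpha>]
  by (smt (verit) mem_Collect_eq mult_nonneg_nonneg mult_nonneg_nonpos)

lemma rcis_in_closed_sector:
  assumes "0 \<le> r" "\<bar>\<theta>\<bar> \<le> \<alpha>"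
  shows "rcis r \<theta> \<in> closed_sector \<alpha>"
proof -
  have "0 \<le> r * sin (\<alpha> - \<theta>)" "0 \<le> r * sin (\<alpha> + \<theta>)"
    using assms \<alpha> by (auto intro!: mult_nonneg_nonneg sin_ge_zero)
  then show ?thesis
    using assms by (auto simp: closed_sector_def sin_add sin_diff abs_if algebra_simps)
qed

lemma rcis_in_sector:
  assumes "0 < r" "\<bar>\<theta>\<bar> < \<alpha>"
  shows "rcis r \<theta> \<in> sector \<alpha>"
proof -
  have "0 < r * sin (\<alpha> - \<theta>)" "0 < r * sin (\<alpha> + \<theta>)"
    using assms \<alpha> by (auto intro!: mult_pos_pos sin_gt_zero)
  then show ?thesis
    using assms by (auto simp: sector_altdef[OF \<alpha>] sin_add sin_diff abs_if algebra_simps)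
qed

text \<open>The disc of radius \<open>t * sin \<alpha>\<close> about \<open>z + t\<close> stays
  inside the sector, while \<open>z\<close> is at distance \<open>t\<close>. The ratio of the two is
  \<open>1 / sin \<alpha>\<close>, and the factor 2 in the aperture makes the inequality
  strict.\<close>

lemma shift_in_nontangential_region:
  assumes z: "z \<in> closed_sector \<alpha>" and "0 < t"
  shows "z + of_real t \<in> nontangential_region \<alpha> (2 / sin \<alpha>) z"
proof -
  let ?F = "frontier (sector \<alpha>)"
  have ball: "x \<in> sector \<alpha>" if "dist (z + of_real t) x < t * sin \<alpha>" for x
  proof -
    define u where "u = x - (z + of_real t)"
    have "norm u < t * sin \<alpha>" using that by (simp add: u_def dist_norm norm_minus_commute)
    then have "of_real t + u \<in> sector \<alpha>"
      using abs_Im_sector_form_le[of \<alpha> u] by (simp add: sector_altdef[OF \<alpha>] algebra_simps)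
    from closed_sector_add[OF z this] show ?thesis by (simp add: u_def)
  qed
  \<comment> \<open>The frontier must be shown to be nonempty, since \<open>infdist\<close> to the
    empty set is 0 by convention.\<close>
  have "\<not> (0::complex) \<in> sector \<alpha>" "of_real 1 \<in> sector \<alpha>"
    using of_real_in_sector[of 1] by (auto simp: sector_def)
  then have "?F \<noteq> {}"
    by (metis UNIV_I empty_iff frontier_eq_empty)
  moreover have "t * sin \<alpha> \<le> dist (z + of_real t) x" if "x \<in> ?F" for x
    using that ball[of x] open_sector by (force simp: frontier_def interior_open)
  ultimately have "t * sin \<alpha> \<le> infdist (z + of_real t) ?F"
    by (auto simp: infdist_def intro!: cINF_greatest)
  then have "2 / sin \<alpha> * (t * sin \<alpha>) \<le> 2 / sin \<alpha> * infdist (z + of_real t) ?F"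
    using sin_cos_pos by (intro mult_left_mono) auto
  then have "dist (z + of_real t) z < 2 / sin \<alpha> * infdist (z + of_real t) ?F"
    using sin_cos_pos \<open>0 < t\<close> by (simp add: dist_norm)
  with closed_sector_add[OF z of_real_in_sector[OF \<open>0 < t\<close>]] show ?thesis
    by (simp add: nontangential_region_def)
qed

text \<open>The part of the open sector to the left of the third side is an open set contained in
  the triangle, as explicit barycentric coordinates show.\<close>

lemma interior_sector_triangle:
  assumes w: "w \<in> sector \<alpha>" and R: "Re w < R * cos \<alpha>"
  shows "w \<in> interior (convex hull {0, rcis R \<alpha>, rcis R (- \<alpha>)})"
proof -
  let ?U = "sector \<alpha> \<inter> {z. Re z < R * cos \<alpha>}"
  note pos = sin_cos_pos
  have "0 < R * cos \<alpha>" using Re_sector_pos[OF w] R by simp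
  then have "0 < R" using pos by (simp add: zero_less_mult_iff)
  have "?U \<subseteq> convex hull {0, rcis R \<alpha>, rcis R (- \<alpha>)}"
  proof
    fix z assume z: "z \<in> ?U"
    \<comment> \<open>\<open>p\<close> is the real part of \<open>z\<close> relative to the third
      side, and \<open>q\<close> the imaginary part relative to its half-length. The sector
      condition reads |q| < p, and the weights of the three vertices are 1 - p, (p + q)/2 and (p -
      q)/2.\<close>
    define p q where "p = Re z / (R * cos \<alpha>)" and "q = Im z / (R * sin \<alpha>)"
    have "p < 1" using z \<open>0 < R * cos \<alpha>\<close> by (simp add: p_def)
    have "\<bar>q\<bar> < p"
      using z pos \<open>0 < R\<close> by (simp add: p_def q_def sector_altdef[OF \<alpha>] field_simps)
    have "z = ((1 - p) *\<^sub>R 0 + ((p + q) / 2) *\<^sub>R rcis R \<alpha> + ((p - q) / 2) *\<^sub>R rcis R (- \<alpha>))"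
      using pos \<open>0 < R\<close> by (simp add: complex_eq_iff p_def q_def field_simps)
    moreover have "0 \<le> 1 - p" "0 \<le> (p + q) / 2" "0 \<le> (p - q) / 2"
      "(1 - p) + (p + q) / 2 + (p - q) / 2 = 1"
      using \<open>p < 1\<close> \<open>\<bar>q\<bar> < p\<close> by (auto simp: abs_if field_simps split: if_splits)
    ultimately show "z \<in> convex hull {0, rcis R \<alpha>, rcis R (- \<alpha>)}"
      unfolding convex_hull_3 by blast
  qed
  moreover have "open ?U"
    by (intro open_Int open_sector open_Collect_less continuous_intros)
  ultimately show ?thesis
    using w R by (intro interiorI[of ?U]) auto
qed

end

section \<open>Null sets under affine maps, and the edges of the triangles\<close>

text \<open>An invertible diagonal affine map scales Lebesgue measure by a positive constant, so
  preimages of null sets are null. This transfers statements about almost all pairs of radii to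
  almost all pairs of edge parameters.\<close>

lemma AE_lborel_affine_prod:
  fixes P :: "real \<times> real \<Rightarrow> bool"
  assumes "c\<^sub>1 \<noteq> 0" "c\<^sub>2 \<noteq> 0" and P: "AE r in lborel. P r"
  shows "AE r in lborel. P (t\<^sub>1 + c\<^sub>1 * fst r, t\<^sub>2 + c\<^sub>2 * snd r)"
proof -
  let ?T = "\<lambda>r::real \<times> real. (t\<^sub>1 + c\<^sub>1 * fst r, t\<^sub>2 + c\<^sub>2 * snd r)"
  obtain N where N: "{r. \<not> P r} \<subseteq> N" "N \<in> sets lborel" "emeasure lborel N = 0"
    using P by (auto elim!: AE_E)
  have T [measurable]: "?T \<in> borel_measurable borel"
    by (intro borel_measurable_continuous_onI continuous_intros)
  have [measurable]: "N \<in> sets borel"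
    using N by simp
  \<comment> \<open>The two scale factors are indexed by the standard basis of the plane:
    \<open>(1, 0)\<close> gets the first, \<open>(0, 1)\<close> the second.\<close>
  define c :: "real \<times> real \<Rightarrow> real" where "c = (\<lambda>j. if j = (1, 0) then c\<^sub>1 else c\<^sub>2)"
  have "lborel = density (distr lborel borel ?T) (\<lambda>_. ennreal (\<Prod>j\<in>Basis. \<bar>c j\<bar>))"
    using lborel_affine_euclidean[of c "(t\<^sub>1, t\<^sub>2)"] assms
    by (simp add: c_def Basis_prod_def inner_prod_def image_iff)
  then have "0 = emeasure (density (distr lborel borel ?T) (\<lambda>_. ennreal (\<Prod>j\<in>Basis. \<bar>c j\<bar>))) N"
    using N(3) by simp
  also have "\<dots> = ennreal (\<Prod>j\<in>Basis. \<bar>c j\<bar>) * emeasure lborel (?T -` N)"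
    by (subst emeasure_density) (auto simp: nn_integral_cmult emeasure_distr)
  finally have "ennreal (\<Prod>j\<in>Basis. \<bar>c j\<bar>) * emeasure lborel (?T -` N) = 0" ..
  moreover have "0 < (\<Prod>j\<in>Basis. \<bar>c j\<bar>)"
    using assms by (intro prod_pos) (auto simp: c_def)
  ultimately have "emeasure lborel (?T -` N) = 0"
    by (simp add: ennreal_eq_0_iff)
  moreover have "?T -` N \<in> sets lborel"
    using measurable_sets[OF T \<open>N \<in> sets borel\<close>] by simp
  ultimately have "?T -` N \<in> null_sets lborel" by auto
  then show ?thesis
    by (rule AE_I') (use N(1) in auto)
qed

text \<open>Index 3 falls into the last case together with index 0, so that edge 2, which runs from
  vertex 2 to vertex 3, closes the triangle at the origin.\<close>

definition sector_vertex :: "real \<Rightarrow> real \<Rightarrow> nat \<Rightarrow> complex" where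
  "sector_vertex R \<alpha> i = (if i = 1 then rcis R \<alpha> else if i = 2 then rcis R (- \<alpha>) else 0)"

text \<open>The edges 0 and 2 lie on the boundary rays, the edge 1 is the side away from the origin.\<close>

definition sector_edge :: "real \<Rightarrow> real \<Rightarrow> nat \<Rightarrow> real \<Rightarrow> complex" where
  "sector_edge R \<alpha> i = linepath (sector_vertex R \<alpha> i) (sector_vertex R \<alpha> (Suc i))"

lemma convex_closed_sector:
  assumes "0 < \<alpha>" "\<alpha> < pi / 2"
  shows "convex (closed_sector \<alpha>)"
proof -
  have "cos \<alpha> * \<bar>x\<bar> = \<bar>cos \<alpha> * x\<bar>" for x
    using sin_cos_pos[OF assms] by (simp add: abs_mult)
  then have "closed_sector \<alpha> =
      {z. inner (Complex (- sin \<alpha>) (cos \<alpha>)) z \<le> 0} \<inter> {z. inner (Complex (- sin \<alpha>) (- cos \<alpha>)) z \<le> 0}"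
    by (auto simp: closed_sector_def inner_complex_def abs_le_iff)
  then show ?thesis
    by (metis convex_Int convex_halfspace_le)
qed

lemma sector_edge_simps:
  "sector_edge R \<alpha> 0 x = rcis (R * x) \<alpha>"
  "sector_edge R \<alpha> 2 x = rcis (R + (- R) * x) (- \<alpha>)"
  "Re (sector_edge R \<alpha> 1 x) = R * cos \<alpha>"
  by (simp_all add: sector_edge_def sector_vertex_def linepath_def complex_eq_iff algebra_simps)

lemma continuous_on_sector_edge [continuous_intros]:
  "continuous_on A f \<Longrightarrow> continuous_on A (\<lambda>x. sector_edge R \<alpha> i (f x))"
  unfolding sector_edge_def linepath_def by (intro continuous_intros)

context
  fixes \<alpha> :: real
  assumes \<alpha>: "0 < \<alpha>" "\<alpha> < pi / 2"
begin

lemma sector_edge_in_closed_sector: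
  assumes "0 \<le> R" "x \<in> {0..1}"
  shows "sector_edge R \<alpha> i x \<in> closed_sector \<alpha>"
proof -
  have "sector_vertex R \<alpha> k \<in> closed_sector \<alpha>" for k
    using assms \<alpha> rcis_in_closed_sector[OF \<alpha>, of R] rcis_in_closed_sector[OF \<alpha>, of 0 0]
    by (auto simp: sector_vertex_def)
  then show ?thesis
    using closed_segment_subset[OF _ _ convex_closed_sector[OF \<alpha>]] linepath_in_path[of x] assms(2)
    unfolding sector_edge_def by blast
qed

lemma sector_edge_shift_in_sector:
  assumes "0 \<le> R" "x \<in> {0..1}" "0 < t"
  shows "sector_edge R \<alpha> i x + of_real t \<in> sector \<alpha>"
  using closed_sector_add[OF \<alpha>] sector_edge_in_closed_sector of_real_in_sector[OF \<alpha>] assms by blast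

text \<open>The function z -> \<phi>(z + t) is holomorphic on the sector translated by -t, an open
  convex set that contains the whole closed sector and hence all three vertices. The triangle itself
  does not move, so \<open>K\<close> is independent of \<open>t\<close>.\<close>

lemma Cauchy_sector_norm_le:
  assumes w: "w \<in> sector \<alpha>" "Re w < R * cos \<alpha>"
  obtains K where "0 \<le> K"
    "\<And>t \<phi>. 0 < t \<Longrightarrow> \<phi> holomorphic_on sector \<alpha> \<Longrightarrow>
       ennreal (norm (\<phi> (w + of_real t))) \<le> ennreal K *
         (\<Sum>i<3. \<integral>\<^sup>+x. ennreal (norm (\<phi> (sector_edge R \<alpha> i x + of_real t))) * indicator {0<..<1} x \<partial>lborel)"
proof -
  have "0 < R * cos \<alpha>" using Re_sector_pos[OF \<alpha> w(1)] w(2) by simp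
  then have "0 \<le> R" using sin_cos_pos[OF \<alpha>] by (simp add: zero_less_mult_iff)
  obtain K where "0 \<le> K" and K:
    "\<And>S \<phi>. open S \<Longrightarrow> convex S \<Longrightarrow> {0, rcis R \<alpha>, rcis R (- \<alpha>)} \<subseteq> S \<Longrightarrow> \<phi> holomorphic_on S \<Longrightarrow>
       ennreal (norm (\<phi> w)) \<le> ennreal K *
         ((\<integral>\<^sup>+x. ennreal (norm (\<phi> (linepath 0 (rcis R \<alpha>) x))) * indicator {0<..<1} x \<partial>lborel)
        + (\<integral>\<^sup>+x. ennreal (norm (\<phi> (linepath (rcis R \<alpha>) (rcis R (- \<alpha>)) x))) * indicator {0<..<1} x \<partial>lborel)
        + (\<integral>\<^sup>+x. ennreal (norm (\<phi> (linepath (rcis R (- \<alpha>)) 0 x))) * indicator {0<..<1} x \<partial>lborel))"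
    by (rule Cauchy_triangle_norm_le[OF interior_sector_triangle[OF \<alpha> w]]) (rule that)
  show thesis
  proof (rule that[OF \<open>0 \<le> K\<close>])
    fix t :: real and \<phi> assume "0 < t" and hol: "\<phi> holomorphic_on sector \<alpha>"
    let ?S = "(\<lambda>z. - of_real t + z) ` sector \<alpha>"
    have "ennreal (norm (\<phi> (w + of_real t))) \<le> ennreal K *
       ((\<integral>\<^sup>+x. ennreal (norm (\<phi> (linepath 0 (rcis R \<alpha>) x + of_real t))) * indicator {0<..<1} x \<partial>lborel)
      + (\<integral>\<^sup>+x. ennreal (norm (\<phi> (linepath (rcis R \<alpha>) (rcis R (- \<alpha>)) x + of_real t))) * indicator {0<..<1} x \<partial>lborel)
      + (\<integral>\<^sup>+x. ennreal (norm (\<phi> (linepath (rcis R (- \<alpha>)) 0 x + of_real t))) * indicator {0<..<1} x \<partial>lborel))"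
    proof (rule K[of ?S "\<lambda>z. \<phi> (z + of_real t)"])
      show "open ?S" "convex ?S"
        by (rule open_translation[OF open_sector[OF \<alpha>]], rule convex_translation[OF convex_sector[OF \<alpha>]])
      have "z \<in> ?S" if "z \<in> closed_sector \<alpha>" for z
        using closed_sector_add[OF \<alpha> that of_real_in_sector[OF \<alpha> \<open>0 < t\<close>]]
        by (intro image_eqI[of _ _ "z + of_real t"]) auto
      then show "{0, rcis R \<alpha>, rcis R (- \<alpha>)} \<subseteq> ?S"
        using rcis_in_closed_sector[OF \<alpha>, of R] rcis_in_closed_sector[OF \<alpha>, of 0 0] \<alpha> \<open>0 \<le> R\<close> by auto
      show "(\<lambda>z. \<phi> (z + of_real t)) holomorphic_on ?S"
        by (rule holomorphic_on_compose_gen[OF _ hol, unfolded o_def]) (auto intro!: holomorphic_intros)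
    qed
    also have "\<dots> = ennreal K *
         (\<Sum>i<3. \<integral>\<^sup>+x. ennreal (norm (\<phi> (sector_edge R \<alpha> i x + of_real t))) * indicator {0<..<1} x \<partial>lborel)"
      by (simp add: numeral_3_eq_3 sector_edge_def sector_vertex_def)
    finally show "ennreal (norm (\<phi> (w + of_real t))) \<le> \<dots>" .
  qed
qed

end

text \<open>If \<open>a / b\<close> exceeded 1, its powers would exceed \<open>C\<close>. This is
  how the constant of Cauchy's formula disappears.\<close>

lemma le_if_powers_le:
  fixes a b C :: real
  assumes "0 < b" "\<And>n. 0 < n \<Longrightarrow> a ^ n \<le> C * b ^ n"
  shows "a \<le> b"
proof (rule ccontr)
  assume "\<not> a \<le> b"
  then have "1 < a / b" using assms(1) by simp
  then obtain n where n: "C < (a / b) ^ n" using real_arch_pow by blast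
  \<comment> \<open>The exponent \<open>n\<close> may be 0, where the hypothesis says nothing, so
    the next power is used.\<close>
  have "(a / b) ^ n \<le> (a / b) ^ Suc n"
    using \<open>1 < a / b\<close> by (intro power_increasing) auto
  also have "\<dots> \<le> C"
    using assms(2)[of "Suc n"] assms(1) unfolding power_divide by (simp add: divide_le_eq)
  finally show False using n by simp
qed

subsection \<open>A maximum principle on products of sectors\<close>

text \<open>Holomorphy in each variable serves the iterated one-variable Cauchy formula. Joint
  continuity supplies the measurability for Tonelli's theorem and the limit of small translates at
  interior points.\<close>

definition separately_holomorphic_on ::
    "(complex \<times> complex \<Rightarrow> complex) \<Rightarrow> complex set \<Rightarrow> complex set \<Rightarrow> bool" where
  "separately_holomorphic_on f S T \<longleftrightarrow> continuous_on (S \<times> T) f \<and>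
     (\<forall>z\<^sub>2\<in>T. (\<lambda>z\<^sub>1. f (z\<^sub>1, z\<^sub>2)) holomorphic_on S) \<and> (\<forall>z\<^sub>1\<in>S. (\<lambda>z\<^sub>2. f (z\<^sub>1, z\<^sub>2)) holomorphic_on T)"

lemma separately_holomorphic_onD:
  assumes "separately_holomorphic_on f S T"
  shows "continuous_on (S \<times> T) f"
    and "z\<^sub>2 \<in> T \<Longrightarrow> (\<lambda>z\<^sub>1. f (z\<^sub>1, z\<^sub>2)) holomorphic_on S"
    and "z\<^sub>1 \<in> S \<Longrightarrow> (\<lambda>z\<^sub>2. f (z\<^sub>1, z\<^sub>2)) holomorphic_on T"
  using assms by (auto simp: separately_holomorphic_on_def)

lemma separately_holomorphic_on_power:
  "separately_holomorphic_on f S T \<Longrightarrow> separately_holomorphic_on (\<lambda>z. f z ^ n) S T"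
  by (auto simp: separately_holomorphic_on_def intro!: continuous_intros holomorphic_intros)

lemma separately_holomorphic_on_times:
  assumes "separately_holomorphic_on f S T" "g holomorphic_on S" "h holomorphic_on T"
  shows "separately_holomorphic_on (\<lambda>z. f z * g (fst z) * h (snd z)) S T"
proof -
  have "continuous_on (S \<times> T) (\<lambda>z. g (fst z))" "continuous_on (S \<times> T) (\<lambda>z. h (snd z))"
    using holomorphic_on_imp_continuous_on[OF assms(2)] holomorphic_on_imp_continuous_on[OF assms(3)]
    by (auto intro!: continuous_on_compose2[of S g] continuous_on_compose2[of T h] continuous_intros)
  with assms show ?thesis
    by (auto simp: separately_holomorphic_on_def intro!: continuous_intros holomorphic_intros)
qed

text \<open>The one-variable estimate is applied in the first variable with the second one frozen,
  and then in the second variable at each point of the three edges of the first triangle. Tonelli's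
  theorem turns the iterated integrals into nine integrals over the unit square, and the constants
  multiply.\<close>

lemma polysector_Cauchy_norm_le:
  assumes \<alpha>\<^sub>1: "0 < \<alpha>\<^sub>1" "\<alpha>\<^sub>1 < pi / 2" and \<alpha>\<^sub>2: "0 < \<alpha>\<^sub>2" "\<alpha>\<^sub>2 < pi / 2"
    and w\<^sub>1: "w\<^sub>1 \<in> sector \<alpha>\<^sub>1" "Re w\<^sub>1 < R\<^sub>1 * cos \<alpha>\<^sub>1"
    and w\<^sub>2: "w\<^sub>2 \<in> sector \<alpha>\<^sub>2" "Re w\<^sub>2 < R\<^sub>2 * cos \<alpha>\<^sub>2"
  obtains K where "0 \<le> K"
    "\<And>t G. 0 < t \<Longrightarrow> separately_holomorphic_on G (sector \<alpha>\<^sub>1) (sector \<alpha>\<^sub>2) \<Longrightarrow>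
       ennreal (norm (G (w\<^sub>1 + of_real t, w\<^sub>2 + of_real t))) \<le> ennreal K *
         (\<Sum>i<3. \<Sum>j<3. \<integral>\<^sup>+p. ennreal (norm (G (sector_edge R\<^sub>1 \<alpha>\<^sub>1 i (fst p) + of_real t,
            sector_edge R\<^sub>2 \<alpha>\<^sub>2 j (snd p) + of_real t))) * indicator ({0<..<1} \<times> {0<..<1}) p \<partial>lborel)"
proof -
  obtain K\<^sub>1 where "0 \<le> K\<^sub>1" and K\<^sub>1: "\<And>t \<phi>. 0 < t \<Longrightarrow> \<phi> holomorphic_on sector \<alpha>\<^sub>1 \<Longrightarrow>
       ennreal (norm (\<phi> (w\<^sub>1 + of_real t))) \<le> ennreal K\<^sub>1 *
         (\<Sum>i<3. \<integral>\<^sup>+x. ennreal (norm (\<phi> (sector_edge R\<^sub>1 \<alpha>\<^sub>1 i x + of_real t))) * indicator {0<..<1} x \<partial>lborel)"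
    by (rule Cauchy_sector_norm_le[OF \<alpha>\<^sub>1 w\<^sub>1]) (rule that)
  obtain K\<^sub>2 where "0 \<le> K\<^sub>2" and K\<^sub>2: "\<And>t \<phi>. 0 < t \<Longrightarrow> \<phi> holomorphic_on sector \<alpha>\<^sub>2 \<Longrightarrow>
       ennreal (norm (\<phi> (w\<^sub>2 + of_real t))) \<le> ennreal K\<^sub>2 *
         (\<Sum>i<3. \<integral>\<^sup>+x. ennreal (norm (\<phi> (sector_edge R\<^sub>2 \<alpha>\<^sub>2 i x + of_real t))) * indicator {0<..<1} x \<partial>lborel)"
    by (rule Cauchy_sector_norm_le[OF \<alpha>\<^sub>2 w\<^sub>2]) (rule that)
  have R: "0 \<le> R\<^sub>1" "0 \<le> R\<^sub>2"
    using Re_sector_pos[OF \<alpha>\<^sub>1 w\<^sub>1(1)] Re_sector_pos[OF \<alpha>\<^sub>2 w\<^sub>2(1)] w\<^sub>1(2) w\<^sub>2(2)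
      sin_cos_pos(2)[OF \<alpha>\<^sub>1] sin_cos_pos(2)[OF \<alpha>\<^sub>2]
    by (smt (verit) mult_nonneg_nonneg mult_nonpos_nonneg)+
  show thesis
  proof (rule that[of "K\<^sub>1 * K\<^sub>2"])
    show "0 \<le> K\<^sub>1 * K\<^sub>2" using \<open>0 \<le> K\<^sub>1\<close> \<open>0 \<le> K\<^sub>2\<close> by simp
  next
    fix t :: real and G :: "complex \<times> complex \<Rightarrow> complex"
    assume "0 < t" and G: "separately_holomorphic_on G (sector \<alpha>\<^sub>1) (sector \<alpha>\<^sub>2)"
    note cont = separately_holomorphic_onD(1)[OF G]
      and hol\<^sub>1 = separately_holomorphic_onD(2)[OF G]
      and hol\<^sub>2 = separately_holomorphic_onD(3)[OF G]
    let ?e = "\<lambda>i x. sector_edge R\<^sub>1 \<alpha>\<^sub>1 i x + of_real t"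
    let ?f = "\<lambda>j y. sector_edge R\<^sub>2 \<alpha>\<^sub>2 j y + of_real t"
    let ?Q = "{0<..<1} \<times> {0<..<1::real} :: (real \<times> real) set"
    define u where "u i j p = ennreal (norm (G (?e i (fst p), ?f j (snd p)))) * indicator ?Q p" for i j p
    have meas: "u i j \<in> borel_measurable (lborel \<Otimes>\<^sub>M lborel)" for i j
    proof -
      have "continuous_on ?Q (\<lambda>p. G (?e i (fst p), ?f j (snd p)))"
        by (rule continuous_on_compose2[OF cont])
          (use sector_edge_shift_in_sector[OF \<alpha>\<^sub>1 R(1)] sector_edge_shift_in_sector[OF \<alpha>\<^sub>2 R(2)] \<open>0 < t\<close>
            in \<open>auto intro!: continuous_intros\<close>)
      then have "(\<lambda>p. indicator ?Q p *\<^sub>R G (?e i (fst p), ?f j (snd p))) \<in> borel_measurable borel"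
        by (intro borel_measurable_continuous_on_indicator borel_open open_Times) auto
      then have "(\<lambda>p. ennreal (norm (indicator ?Q p *\<^sub>R G (?e i (fst p), ?f j (snd p))))) \<in> borel_measurable lborel"
        by measurable
      also have "(\<lambda>p. ennreal (norm (indicator ?Q p *\<^sub>R G (?e i (fst p), ?f j (snd p))))) = u i j"
        by (auto simp: fun_eq_iff u_def indicator_def)
      finally show ?thesis
        by (simp add: lborel_prod)
    qed
    have [measurable]: "(\<lambda>x. \<integral>\<^sup>+y. u i j (x, y) \<partial>lborel) \<in> borel_measurable lborel" for i j
      using lborel.borel_measurable_nn_integral_fst[OF meas] .
    \<comment> \<open>The shift by \<open>t\<close> puts the edge point inside the first sector,
      where the second-variable slice is holomorphic; outside the open unit interval the left side
      is 0.\<close>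
    have inner: "ennreal (norm (G (?e i x, w\<^sub>2 + of_real t))) * indicator {0<..<1} x \<le>
        ennreal K\<^sub>2 * (\<Sum>j<3. \<integral>\<^sup>+y. u i j (x, y) \<partial>lborel)" for i x
    proof (cases "x \<in> {0<..<1}")
      case True
      then have "?e i x \<in> sector \<alpha>\<^sub>1"
        using sector_edge_shift_in_sector[OF \<alpha>\<^sub>1 R(1) _ \<open>0 < t\<close>] by simp
      from K\<^sub>2[OF \<open>0 < t\<close> hol\<^sub>2[OF this]] show ?thesis
        using True by (simp add: u_def indicator_times)
    qed simp
    have "ennreal (norm (G (w\<^sub>1 + of_real t, w\<^sub>2 + of_real t))) \<le> ennreal K\<^sub>1 *
        (\<Sum>i<3. \<integral>\<^sup>+x. ennreal (norm (G (?e i x, w\<^sub>2 + of_real t))) * indicator {0<..<1} x \<partial>lborel)"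
    proof (rule K\<^sub>1[OF \<open>0 < t\<close> hol\<^sub>1])
      show "w\<^sub>2 + of_real t \<in> sector \<alpha>\<^sub>2"
        using closed_sector_add[OF \<alpha>\<^sub>2] of_real_in_sector[OF \<alpha>\<^sub>2 \<open>0 < t\<close>]
          sector_subset_closed_sector[OF \<alpha>\<^sub>2] w\<^sub>2(1) by blast
    qed
    also have "\<dots> \<le> ennreal K\<^sub>1 *
        (\<Sum>i<3. \<integral>\<^sup>+x. ennreal K\<^sub>2 * (\<Sum>j<3. \<integral>\<^sup>+y. u i j (x, y) \<partial>lborel) \<partial>lborel)"
      by (intro mult_left_mono sum_mono nn_integral_mono inner) simp
    also have "\<dots> = ennreal K\<^sub>1 *
        (\<Sum>i<3. ennreal K\<^sub>2 * (\<Sum>j<3. \<integral>\<^sup>+x. \<integral>\<^sup>+y. u i j (x, y) \<partial>lborel \<partial>lborel))"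
      by (simp add: nn_integral_cmult nn_integral_sum)
    also have "\<dots> = ennreal K\<^sub>1 * (\<Sum>i<3. ennreal K\<^sub>2 * (\<Sum>j<3. \<integral>\<^sup>+p. u i j p \<partial>lborel))"
      by (simp only: lborel.nn_integral_fst[OF meas]) (simp only: lborel_prod)
    also have "\<dots> = ennreal (K\<^sub>1 * K\<^sub>2) * (\<Sum>i<3. \<Sum>j<3. \<integral>\<^sup>+p. u i j p \<partial>lborel)"
      using \<open>0 \<le> K\<^sub>1\<close> \<open>0 \<le> K\<^sub>2\<close> by (simp add: ennreal_mult mult.assoc flip: sum_distrib_left)
    finally show "ennreal (norm (G (w\<^sub>1 + of_real t, w\<^sub>2 + of_real t))) \<le> ennreal (K\<^sub>1 * K\<^sub>2) *
      (\<Sum>i<3. \<Sum>j<3. \<integral>\<^sup>+p. ennreal (norm (G (?e i (fst p), ?f j (snd p)))) * indicator ?Q p \<partial>lborel)"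
      unfolding u_def .
  qed
qed

text \<open>Edge 0 runs outward along one boundary ray and edge 2 inward along the other. In both
  cases the radius is a nonconstant affine function of the parameter, the form required by
  \<open>AE_lborel_affine_prod\<close>.\<close>

lemma sector_edge_on_ray:
  assumes "k < 3" "k \<noteq> 1" "0 < R"
  obtains c d \<sigma> where "c \<noteq> 0" "\<sigma> \<in> {\<alpha>, - \<alpha>}" "\<And>x. sector_edge R \<alpha> k x = rcis (d + c * x) \<sigma>"
    "\<And>x. x \<in> {0<..<1} \<Longrightarrow> 0 < d + c * x"
proof -
  consider "k = 0" | "k = 2" using assms by linarith
  then show thesis
  proof cases
    case 1
    then show ?thesis
      using that[of R \<alpha> 0] assms by (simp add: sector_edge_simps)
  next
    case 2
    then show ?thesis
      using that[of "- R" "- \<alpha>" R] assms by (simp add: sector_edge_simps)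
  qed
qed

text \<open>The Cauchy estimate holds for every power of \<open>F\<close> with the same
  \<open>K\<close>. Of the nine edge pairs, four lie on products of boundary rays and are controlled
  in the limit by \<open>bdry\<close>; the other five contain a far side and are controlled by
  \<open>far\<close>. Each integral of the n-th power is thus asymptotically at most
  \<open>M ^ n\<close>, and comparing powers removes the constant \<open>9 * K\<close>.\<close>

lemma polysector_maximum_principle:
  fixes F :: "complex \<times> complex \<Rightarrow> complex"
  assumes \<alpha>\<^sub>1: "0 < \<alpha>\<^sub>1" "\<alpha>\<^sub>1 < pi / 2" and \<alpha>\<^sub>2: "0 < \<alpha>\<^sub>2" "\<alpha>\<^sub>2 < pi / 2"
    and hol: "separately_holomorphic_on F (sector \<alpha>\<^sub>1) (sector \<alpha>\<^sub>2)"
    and bdd: "\<And>z\<^sub>1 z\<^sub>2. z\<^sub>1 \<in> sector \<alpha>\<^sub>1 \<Longrightarrow> z\<^sub>2 \<in> sector \<alpha>\<^sub>2 \<Longrightarrow> norm (F (z\<^sub>1, z\<^sub>2)) \<le> B"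
    and far: "\<And>z\<^sub>1 z\<^sub>2. z\<^sub>1 \<in> sector \<alpha>\<^sub>1 \<Longrightarrow> z\<^sub>2 \<in> sector \<alpha>\<^sub>2 \<Longrightarrow> R \<le> norm z\<^sub>1 \<or> R \<le> norm z\<^sub>2 \<Longrightarrow>
        norm (F (z\<^sub>1, z\<^sub>2)) \<le> M"
    and bdry: "\<And>\<sigma>\<^sub>1 \<sigma>\<^sub>2. \<sigma>\<^sub>1 \<in> {\<alpha>\<^sub>1, - \<alpha>\<^sub>1} \<Longrightarrow> \<sigma>\<^sub>2 \<in> {\<alpha>\<^sub>2, - \<alpha>\<^sub>2} \<Longrightarrow>
        AE r in (lborel :: (real \<times> real) measure). 0 < fst r \<longrightarrow> 0 < snd r \<longrightarrow>
          (\<exists>L. norm L \<le> M \<and>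
            ((\<lambda>t. F (rcis (fst r) \<sigma>\<^sub>1 + of_real t, rcis (snd r) \<sigma>\<^sub>2 + of_real t)) \<longlongrightarrow> L) (at_right 0))"
    and w: "w\<^sub>1 \<in> sector \<alpha>\<^sub>1" "w\<^sub>2 \<in> sector \<alpha>\<^sub>2"
  shows "norm (F (w\<^sub>1, w\<^sub>2)) \<le> M"
proof -
  note cont = separately_holomorphic_onD(1)[OF hol]
  have "0 \<le> M"
    using far[of "of_real (max R 1)" "of_real (max R 1)"] norm_ge_zero order_trans
      of_real_in_sector[OF \<alpha>\<^sub>1, of "max R 1"] of_real_in_sector[OF \<alpha>\<^sub>2, of "max R 1"]
    by (metis abs_of_pos less_max_iff_disj max.cobounded1 norm_of_real zero_less_one)
  note cos = sin_cos_pos(2)[OF \<alpha>\<^sub>1] sin_cos_pos(2)[OF \<alpha>\<^sub>2]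
  note Re_w = Re_sector_pos[OF \<alpha>\<^sub>1 w(1)] Re_sector_pos[OF \<alpha>\<^sub>2 w(2)]
  \<comment> \<open>The triangle is large enough to contain the given point in its interior and to
    keep its third side, where the real part is \<open>R\<^sub>1 * cos \<alpha>\<^sub>1\<close>, at
    distance at least \<open>R\<close> from the origin. The maximum with 0 covers negative
    \<open>R\<close>.\<close>
  define R\<^sub>1 where "R\<^sub>1 = (max R 0 + Re w\<^sub>1 + 1) / cos \<alpha>\<^sub>1"
  define R\<^sub>2 where "R\<^sub>2 = (max R 0 + Re w\<^sub>2 + 1) / cos \<alpha>\<^sub>2"
  have R\<^sub>1: "Re w\<^sub>1 < R\<^sub>1 * cos \<alpha>\<^sub>1" "R \<le> R\<^sub>1 * cos \<alpha>\<^sub>1" "0 < R\<^sub>1"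
    and R\<^sub>2: "Re w\<^sub>2 < R\<^sub>2 * cos \<alpha>\<^sub>2" "R \<le> R\<^sub>2 * cos \<alpha>\<^sub>2" "0 < R\<^sub>2"
    using cos Re_w by (auto simp: R\<^sub>1_def R\<^sub>2_def intro!: divide_pos_pos)
  let ?e = "\<lambda>i x t. sector_edge R\<^sub>1 \<alpha>\<^sub>1 i x + of_real t"
  let ?f = "\<lambda>j y t. sector_edge R\<^sub>2 \<alpha>\<^sub>2 j y + of_real t"
  let ?Q = "{0<..<1} \<times> {0<..<1::real} :: (real \<times> real) set"
  \<comment> \<open>A sequence of translations decreasing to 0, since Fatou's lemma is applied along
    sequences.\<close>
  define \<tau> where "\<tau> m = 1 / real (Suc m)" for m
  have \<tau>: "\<And>m. 0 < \<tau> m" "\<tau> \<longlonglongrightarrow> 0"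
    using LIMSEQ_inverse_real_of_nat unfolding \<tau>_def by (simp_all add: inverse_eq_divide)
  then have \<tau>_right: "filterlim \<tau> (at_right 0) sequentially"
    using \<tau>(1)[THEN less_imp_neq] by (simp add: filterlim_at)
  have e: "?e i x t \<in> sector \<alpha>\<^sub>1" "?f i x t \<in> sector \<alpha>\<^sub>2" if "x \<in> {0<..<1}" "0 < t" for i x t
    using that sector_edge_shift_in_sector[OF \<alpha>\<^sub>1, of R\<^sub>1 x t] R\<^sub>1(3) R\<^sub>2(3)
      sector_edge_shift_in_sector[OF \<alpha>\<^sub>2, of R\<^sub>2 x t] by auto
  have e_far: "R \<le> norm (?e 1 x t)" "R \<le> norm (?f 1 x t)" if "0 < t" for x t
    using complex_Re_le_cmod[of "?e 1 x t"] complex_Re_le_cmod[of "?f 1 x t"] that R\<^sub>1 R\<^sub>2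
    by (simp_all add: sector_edge_simps del: One_nat_def)
  obtain K where "0 \<le> K" and K: "\<And>t G. 0 < t \<Longrightarrow> separately_holomorphic_on G (sector \<alpha>\<^sub>1) (sector \<alpha>\<^sub>2) \<Longrightarrow>
       ennreal (norm (G (w\<^sub>1 + of_real t, w\<^sub>2 + of_real t))) \<le> ennreal K *
         (\<Sum>i<3. \<Sum>j<3. \<integral>\<^sup>+p. ennreal (norm (G (?e i (fst p) t, ?f j (snd p) t))) * indicator ?Q p \<partial>lborel)"
    by (rule polysector_Cauchy_norm_le[OF \<alpha>\<^sub>1 \<alpha>\<^sub>2 w(1) R\<^sub>1(1) w(2) R\<^sub>2(1)]) (rule that)
  \<comment> \<open>If either edge is a far side, the bound holds for every translate. Otherwise
    both edges lie on boundary rays, and the translates converge for almost every parameter pair to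
    a limit of modulus at most \<open>M\<close>.\<close>
  have limit: "AE p in lborel. p \<in> ?Q \<longrightarrow>
      limsup (\<lambda>m. ennreal (norm (F (?e i (fst p) (\<tau> m), ?f j (snd p) (\<tau> m)) ^ n))) \<le> ennreal (M ^ n)"
    if "i < 3" "j < 3" for i j n
  proof (cases "i = 1 \<or> j = 1")
    case True
    have "norm (F (?e i (fst p) (\<tau> m), ?f j (snd p) (\<tau> m)) ^ n) \<le> M ^ n" if "p \<in> ?Q" for p m
      unfolding norm_power using True that e e_far \<tau>(1)
      by (intro power_mono far) auto
    then show ?thesis
      by (intro AE_I2 impI Limsup_bounded always_eventually allI ennreal_leI)
  next
    case False
    then have "i \<noteq> 1" "j \<noteq> 1" by auto
    obtain c\<^sub>1 d\<^sub>1 \<sigma>\<^sub>1 where 1: "c\<^sub>1 \<noteq> 0" "\<sigma>\<^sub>1 \<in> {\<alpha>\<^sub>1, - \<alpha>\<^sub>1}"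
        "\<And>x. sector_edge R\<^sub>1 \<alpha>\<^sub>1 i x = rcis (d\<^sub>1 + c\<^sub>1 * x) \<sigma>\<^sub>1" "\<And>x. x \<in> {0<..<1} \<Longrightarrow> 0 < d\<^sub>1 + c\<^sub>1 * x"
      by (rule sector_edge_on_ray[OF \<open>i < 3\<close> \<open>i \<noteq> 1\<close> R\<^sub>1(3), of \<alpha>\<^sub>1]) (rule that)
    obtain c\<^sub>2 d\<^sub>2 \<sigma>\<^sub>2 where 2: "c\<^sub>2 \<noteq> 0" "\<sigma>\<^sub>2 \<in> {\<alpha>\<^sub>2, - \<alpha>\<^sub>2}"
        "\<And>x. sector_edge R\<^sub>2 \<alpha>\<^sub>2 j x = rcis (d\<^sub>2 + c\<^sub>2 * x) \<sigma>\<^sub>2" "\<And>x. x \<in> {0<..<1} \<Longrightarrow> 0 < d\<^sub>2 + c\<^sub>2 * x"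
      by (rule sector_edge_on_ray[OF \<open>j < 3\<close> \<open>j \<noteq> 1\<close> R\<^sub>2(3), of \<alpha>\<^sub>2]) (rule that)
    have "AE p in lborel. 0 < d\<^sub>1 + c\<^sub>1 * fst p \<longrightarrow> 0 < d\<^sub>2 + c\<^sub>2 * snd p \<longrightarrow>
          (\<exists>L. norm L \<le> M \<and>
            ((\<lambda>t. F (rcis (d\<^sub>1 + c\<^sub>1 * fst p) \<sigma>\<^sub>1 + of_real t, rcis (d\<^sub>2 + c\<^sub>2 * snd p) \<sigma>\<^sub>2 + of_real t))
              \<longlongrightarrow> L) (at_right 0))"
      using AE_lborel_affine_prod[OF 1(1) 2(1) bdry[OF 1(2) 2(2)], of d\<^sub>1 d\<^sub>2] by simp
    then show ?thesis
    proof (eventually_elim, intro impI)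
      fix p :: "real \<times> real"
      assume "0 < d\<^sub>1 + c\<^sub>1 * fst p \<longrightarrow> 0 < d\<^sub>2 + c\<^sub>2 * snd p \<longrightarrow>
          (\<exists>L. norm L \<le> M \<and>
            ((\<lambda>t. F (rcis (d\<^sub>1 + c\<^sub>1 * fst p) \<sigma>\<^sub>1 + of_real t, rcis (d\<^sub>2 + c\<^sub>2 * snd p) \<sigma>\<^sub>2 + of_real t))
              \<longlongrightarrow> L) (at_right 0))"
        and p: "p \<in> ?Q"
      then obtain L where L: "norm L \<le> M"
          "((\<lambda>t. F (?e i (fst p) t, ?f j (snd p) t)) \<longlongrightarrow> L) (at_right 0)"
        using 1(4)[of "fst p"] 2(4)[of "snd p"] by (auto simp: 1(3) 2(3) mem_Times_iff)
      have "(\<lambda>m. F (?e i (fst p) (\<tau> m), ?f j (snd p) (\<tau> m))) \<longlonglongrightarrow> L"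
        using filterlim_compose[OF L(2) \<tau>_right] .
      then have "(\<lambda>m. ennreal (norm (F (?e i (fst p) (\<tau> m), ?f j (snd p) (\<tau> m)) ^ n))) \<longlonglongrightarrow> ennreal (norm (L ^ n))"
        by (intro tendsto_intros)
      then have "limsup (\<lambda>m. ennreal (norm (F (?e i (fst p) (\<tau> m), ?f j (snd p) (\<tau> m)) ^ n))) = ennreal (norm (L ^ n))"
        by (intro lim_imp_Limsup) auto
      also have "\<dots> \<le> ennreal (M ^ n)"
        using L(1) by (auto simp: norm_power intro!: ennreal_leI power_mono)
      finally show "limsup (\<lambda>m. ennreal (norm (F (?e i (fst p) (\<tau> m), ?f j (snd p) (\<tau> m)) ^ n))) \<le> ennreal (M ^ n)" .
    qed
  qed
  \<comment> \<open>The slack between \<open>M\<close> and \<open>M'\<close> turns a bound on the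
    upper limit into a strict bound for all large \<open>m\<close>; positivity of \<open>n\<close>
    keeps the powers strictly ordered. The factor 9 counts the edge pairs, and continuity at the
    interior point then removes the translation.\<close>
  have key: "norm (F (w\<^sub>1, w\<^sub>2)) ^ n \<le> 9 * K * M' ^ n" if "M < M'" "0 < n" for n M'
  proof -
    let ?I = "\<lambda>i j m. \<integral>\<^sup>+p. ennreal (norm (F (?e i (fst p) (\<tau> m), ?f j (snd p) (\<tau> m)) ^ n)) * indicator ?Q p \<partial>lborel"
    have "eventually (\<lambda>m. ?I i j m < ennreal (M' ^ n)) sequentially" if ij: "i < 3" "j < 3" for i j
    proof -
      let ?u = "\<lambda>m p. ennreal (norm (F (?e i (fst p) (\<tau> m), ?f j (snd p) (\<tau> m)) ^ n)) * indicator ?Q p"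
      have Q: "emeasure lborel ?Q = 1"
        by (simp add: lborel_prod[symmetric] lborel.emeasure_pair_measure_Times)
      have [measurable]: "?Q \<in> sets borel"
        by (intro borel_open open_Times) auto
      have meas: "?u m \<in> borel_measurable lborel" for m
      proof -
        have "continuous_on ?Q (\<lambda>p. F (?e i (fst p) (\<tau> m), ?f j (snd p) (\<tau> m)) ^ n)"
          by (intro continuous_on_power continuous_on_compose2[OF cont])
            (use e \<tau>(1) in \<open>auto intro!: continuous_intros\<close>)
        then have "(\<lambda>p. indicator ?Q p *\<^sub>R F (?e i (fst p) (\<tau> m), ?f j (snd p) (\<tau> m)) ^ n) \<in> borel_measurable borel"
          by (intro borel_measurable_continuous_on_indicator) auto
        then have "(\<lambda>p. ennreal (norm (indicator ?Q p *\<^sub>R F (?e i (fst p) (\<tau> m), ?f j (snd p) (\<tau> m)) ^ n)))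
            \<in> borel_measurable lborel"
          by measurable
        also have "(\<lambda>p. ennreal (norm (indicator ?Q p *\<^sub>R F (?e i (fst p) (\<tau> m), ?f j (snd p) (\<tau> m)) ^ n))) = ?u m"
          by (auto simp: fun_eq_iff indicator_def)
        finally show ?thesis .
      qed
      have "limsup (?I i j) \<le> (\<integral>\<^sup>+p. limsup (\<lambda>m. ?u m p) \<partial>lborel)"
      \<comment> \<open>Fatou's lemma for upper limits needs an integrable majorant: the global
        bound \<open>B\<close> gives \<open>B ^ n\<close> on the unit square, which has measure
        1.\<close>
      proof (rule nn_integral_limsup[where w = "\<lambda>p. ennreal (B ^ n) * indicator ?Q p"])
        have "?u m p \<le> ennreal (B ^ n) * indicator ?Q p" for m p
          using bdd e \<tau>(1) by (auto simp: indicator_def norm_power intro!: ennreal_leI power_mono)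
        then show "\<And>m. AE p in lborel. ?u m p \<le> ennreal (B ^ n) * indicator ?Q p" by simp
        show "(\<integral>\<^sup>+p. ennreal (B ^ n) * indicator ?Q p \<partial>lborel) < \<infinity>"
          using Q by (simp add: nn_integral_cmult_indicator)
      qed (use meas in measurable)
      also have "\<dots> \<le> (\<integral>\<^sup>+p. ennreal (M ^ n) * indicator ?Q p \<partial>lborel)"
        using limit[OF ij, of n]
        by (intro nn_integral_mono_AE, eventually_elim) (simp add: Limsup_const split: split_indicator)
      also have "\<dots> = ennreal (M ^ n)"
        using Q by (simp add: nn_integral_cmult_indicator)
      also have "\<dots> < ennreal (M' ^ n)"
        using \<open>M < M'\<close> \<open>0 \<le> M\<close> \<open>0 < n\<close> by (intro ennreal_lessI) (auto intro: power_strict_mono)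
      finally show ?thesis by (rule Limsup_lessD)
    qed
    then have "eventually (\<lambda>m. \<forall>i\<in>{..<3}. \<forall>j\<in>{..<3}. ?I i j m < ennreal (M' ^ n)) sequentially"
      by (intro eventually_ball_finite ballI) auto
    then have "eventually (\<lambda>m. norm (F (w\<^sub>1 + of_real (\<tau> m), w\<^sub>2 + of_real (\<tau> m)) ^ n) \<le> 9 * K * M' ^ n) sequentially"
    proof eventually_elim
      case (elim m)
      have "ennreal (norm (F (w\<^sub>1 + of_real (\<tau> m), w\<^sub>2 + of_real (\<tau> m)) ^ n)) \<le>
          ennreal K * (\<Sum>i<3. \<Sum>j<3. ?I i j m)"
        using K[OF \<tau>(1) separately_holomorphic_on_power[OF hol]] .
      also have "\<dots> \<le> ennreal K * (\<Sum>i<3::nat. \<Sum>j<3::nat. ennreal (M' ^ n))"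
        using elim by (intro mult_left_mono sum_mono) (auto intro: less_imp_le)
      also have "\<dots> = ennreal (9 * K * M' ^ n)"
        using \<open>0 \<le> K\<close> \<open>0 \<le> M\<close> \<open>M < M'\<close>
        by (simp add: ennreal_mult mult_ac)
      finally show ?case
        using \<open>0 \<le> K\<close> \<open>0 \<le> M\<close> \<open>M < M'\<close> by (subst (asm) ennreal_le_iff) auto
    qed
    moreover have "(\<lambda>m. norm (F (w\<^sub>1 + of_real (\<tau> m), w\<^sub>2 + of_real (\<tau> m)) ^ n)) \<longlonglongrightarrow> norm (F (w\<^sub>1, w\<^sub>2) ^ n)"
    proof (intro tendsto_intros)
      have "isCont F (w\<^sub>1, w\<^sub>2)"
        using cont w open_sector[OF \<alpha>\<^sub>1] open_sector[OF \<alpha>\<^sub>2]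
        by (simp add: continuous_on_eq_continuous_at open_Times)
      moreover have "(\<lambda>m. (w\<^sub>1 + of_real (\<tau> m), w\<^sub>2 + of_real (\<tau> m))) \<longlonglongrightarrow> (w\<^sub>1 + of_real 0, w\<^sub>2 + of_real 0)"
        by (intro tendsto_intros \<tau>)
      ultimately show "(\<lambda>m. F (w\<^sub>1 + of_real (\<tau> m), w\<^sub>2 + of_real (\<tau> m))) \<longlonglongrightarrow> F (w\<^sub>1, w\<^sub>2)"
        by (auto dest: isCont_tendsto_compose)
    qed
    ultimately show ?thesis
      by (simp add: norm_power) (rule tendsto_upperbound, auto)
  qed
  show ?thesis
  \<comment> \<open>Passing to \<open>M + \<epsilon>\<close> gives the room that \<open>key\<close>
    requires and a positive base for the comparison of powers, even when \<open>M\<close> is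
    0.\<close>
  proof (rule field_le_epsilon)
    fix \<epsilon> :: real assume "0 < \<epsilon>"
    then show "norm (F (w\<^sub>1, w\<^sub>2)) \<le> M + \<epsilon>"
      using \<open>0 \<le> M\<close> by (auto intro!: le_if_powers_le[of _ _ "9 * K", OF _ key])
  qed
qed

subsection \<open>Damping factors and the Phragmen-Lindelof argument\<close>

text \<open>The linear term divides out an exponential with prescribed slopes on the boundary rays.
  The power term, with p > 1 and p \<alpha> < pi/2, has a real part of order |z|^p and defeats every
  growth of order one. For \<delta> = 0 the pure exponential quotient is left.\<close>

definition damping :: "complex \<Rightarrow> real \<Rightarrow> real \<Rightarrow> complex \<Rightarrow> complex" where
  "damping a \<delta> p z = exp (- (a * z) - of_real \<delta> * z powr of_real p)"

lemma isCont_damping: "0 < Re z \<Longrightarrow> isCont (damping a \<delta> p) z"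
  unfolding damping_def by (intro continuous_intros) (auto simp: complex_nonpos_Reals_iff)

lemma damping_holomorphic_on:
  assumes "0 < \<alpha>" "\<alpha> < pi / 2"
  shows "damping a \<delta> p holomorphic_on sector \<alpha>"
  unfolding damping_def
  by (intro holomorphic_intros) (force simp: complex_nonpos_Reals_iff dest: Re_sector_pos[OF assms])

lemma norm_damping: "norm (damping a \<delta> p z) = exp (- Re (a * z) - \<delta> * Re (z powr of_real p))"
  by (simp add: damping_def)

text \<open>The real part of the principal power is |z|^p cos(p Arg z), and the cosine decreases on
  the interval from 0 to pi.\<close>

lemma Re_powr_ge:
  assumes "z \<noteq> 0" "\<bar>Arg z\<bar> \<le> \<alpha>" "0 < p" "p * \<alpha> < pi / 2"
  shows "cos (p * \<alpha>) * norm z powr p \<le> Re (z powr of_real p)"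
proof -
  have "0 \<le> p * \<bar>Arg z\<bar>" "p * \<bar>Arg z\<bar> \<le> p * \<alpha>" "p * \<alpha> \<le> pi"
    using assms pi_gt_zero by (simp, simp, linarith)
  then have "cos (p * \<alpha>) \<le> cos (p * \<bar>Arg z\<bar>)"
    by (rule cos_monotone_0_pi_le)
  also have "\<dots> = cos (p * Arg z)"
    by (simp add: abs_if)
  finally have "norm z powr p * cos (p * \<alpha>) \<le> norm z powr p * cos (p * Arg z)"
    by (rule mult_left_mono) simp
  also have "\<dots> = Re (z powr of_real p)"
    using assms(1) by (simp add: powr_def Re_exp Arg_eq_Im_Ln)
  finally show ?thesis by (simp add: mult.commute)
qed

lemma linear_minus_powr_at_bot:
  fixes H c p :: real
  assumes "0 < c" "1 < p" "0 < H"
  shows "filterlim (\<lambda>x. H * x - c * x powr p) at_bot at_top"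
  using assms by real_asymp

text \<open>As p > 1, the power term dominates the linear one, so the exponent tends to minus
  infinity. This yields both a global bound on the half-line and arbitrary smallness far
  out.\<close>

lemma damping_factor_bounds:
  fixes H c p :: real
  assumes "0 < c" "1 < p" "0 < H"
  obtains B where "0 < B" "\<And>x. 0 \<le> x \<Longrightarrow> exp (H * x - c * x powr p) \<le> B"
    "\<And>\<eta>. 0 < \<eta> \<Longrightarrow> \<exists>R. \<forall>x\<ge>R. exp (H * x - c * x powr p) \<le> \<eta>"
proof -
  have small: "\<exists>R. \<forall>x\<ge>R. exp (H * x - c * x powr p) \<le> \<eta>" if "0 < \<eta>" for \<eta>
  proof -
    have "eventually (\<lambda>x. H * x - c * x powr p \<le> ln \<eta>) at_top"
      using linear_minus_powr_at_bot[OF assms] by (simp add: filterlim_at_bot)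
    then obtain R where "\<And>x. R \<le> x \<Longrightarrow> H * x - c * x powr p \<le> ln \<eta>"
      by (auto simp: eventually_at_top_linorder)
    then show ?thesis
      using \<open>0 < \<eta>\<close> by (metis exp_ln exp_le_cancel_iff)
  qed
  from small[of 1] obtain R where R: "\<And>x. R \<le> x \<Longrightarrow> exp (H * x - c * x powr p) \<le> 1" by auto
  show thesis
  \<comment> \<open>Beyond \<open>R\<close> the factor is at most 1; before \<open>R\<close>,
    dropping the power term leaves at most \<open>exp (H * R)\<close>.\<close>
  proof (rule that[of "max 1 (exp (H * R))"])
    fix x :: real assume "0 \<le> x"
    show "exp (H * x - c * x powr p) \<le> max 1 (exp (H * R))"
    proof (cases "R \<le> x")
      case False
      then have "H * x \<le> H * R" "0 \<le> c * x powr p" using assms by auto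
      then have "exp (H * x - c * x powr p) \<le> exp (H * R)" by simp
      then show ?thesis by (rule max.coboundedI2)
    next
      case True
      then show ?thesis by (rule max.coboundedI1[OF R])
    qed
  qed (use small in auto)
qed

lemma norm_damping_le:
  assumes "z \<in> sector \<alpha>" "0 < p" "p * \<alpha> < pi / 2" "0 \<le> \<delta>"
  shows "norm (damping a \<delta> p z) \<le> exp (norm a * norm z - \<delta> * cos (p * \<alpha>) * norm z powr p)"
proof -
  have "- Re (a * z) \<le> norm a * norm z"
    using abs_Re_le_cmod[of "a * z"] by (simp add: norm_mult)
  moreover have "\<delta> * (cos (p * \<alpha>) * norm z powr p) \<le> \<delta> * Re (z powr of_real p)"
    using assms by (intro mult_left_mono Re_powr_ge) (auto simp: sector_def)
  ultimately show ?thesis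
    by (simp add: norm_damping mult.assoc)
qed

text \<open>On the closed sector the power still has nonnegative real part, so the damping term can
  only decrease the norm. The resulting boundary bound does not depend on \<delta>.\<close>

lemma norm_damping_boundary_le:
  assumes "0 < r" "\<bar>\<sigma>\<bar> \<le> \<alpha>" "0 < \<alpha>" "0 < p" "p * \<alpha> < pi / 2" "0 \<le> \<delta>" "\<alpha> < pi / 2"
  shows "norm (damping a \<delta> p (rcis r \<sigma>)) \<le> exp (- Re (a * rcis r \<sigma>))"
proof -
  have "- pi < \<sigma>" "\<sigma> \<le> pi" using assms pi_gt_zero by linarith+
  then have Arg: "Arg (rcis r \<sigma>) = \<sigma>" using assms by (intro Arg_rcis) auto
  have "0 < p * \<alpha>" using assms by simp
  then have "0 \<le> cos (p * \<alpha>) * norm (rcis r \<sigma>) powr p"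
    using assms cos_gt_zero[of "p * \<alpha>"] by simp
  also have "\<dots> \<le> Re (rcis r \<sigma> powr of_real p)"
    using assms Arg by (intro Re_powr_ge) auto
  finally have "0 \<le> \<delta> * Re (rcis r \<sigma> powr of_real p)"
    using assms by simp
  then show ?thesis by (simp add: norm_damping)
qed

section \<open>Analyticity, non-tangential limits and the bound inside the sectors\<close>

text \<open>Along a slice with one coordinate fixed, the complex linear derivative reduces to
  multiplication by \<open>a\<close> or by \<open>b\<close>, which is a complex derivative in the
  remaining variable. Joint continuity is part of Frechet differentiability.\<close>

lemma analytic2_on_imp_separately_holomorphic_on:
  assumes "analytic2_on f (S \<times> T)"
  shows "separately_holomorphic_on f S T"
  unfolding separately_holomorphic_on_def
proof (intro conjI ballI)
  have D: "\<exists>a b. (f has_derivative (\<lambda>(u, v). a * u + b * v)) (at (z\<^sub>1, z\<^sub>2))"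
    if "z\<^sub>1 \<in> S" "z\<^sub>2 \<in> T" for z\<^sub>1 z\<^sub>2
    using assms that unfolding analytic2_on_def by blast
  show "(\<lambda>z\<^sub>1. f (z\<^sub>1, z\<^sub>2)) holomorphic_on S" if z\<^sub>2: "z\<^sub>2 \<in> T" for z\<^sub>2
  proof (rule holomorphic_onI)
    fix z\<^sub>1 assume "z\<^sub>1 \<in> S"
    obtain a b where ab: "(f has_derivative (\<lambda>(u, v). a * u + b * v)) (at (z\<^sub>1, z\<^sub>2))"
      using D[OF \<open>z\<^sub>1 \<in> S\<close> z\<^sub>2] by blast
    have "((\<lambda>z. (z, z\<^sub>2)) has_derivative (\<lambda>u. (u, 0))) (at z\<^sub>1)"
      by (intro derivative_intros)
    from has_derivative_compose[OF this ab]
    have "((\<lambda>z\<^sub>1. f (z\<^sub>1, z\<^sub>2)) has_field_derivative a) (at z\<^sub>1)"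
      by (simp add: has_field_derivative_def)
    then show "(\<lambda>z\<^sub>1. f (z\<^sub>1, z\<^sub>2)) field_differentiable at z\<^sub>1 within S"
      using field_differentiable_def field_differentiable_at_within by blast
  qed
  show "(\<lambda>z\<^sub>2. f (z\<^sub>1, z\<^sub>2)) holomorphic_on T" if z\<^sub>1: "z\<^sub>1 \<in> S" for z\<^sub>1
  proof (rule holomorphic_onI)
    fix z\<^sub>2 assume "z\<^sub>2 \<in> T"
    obtain a b where ab: "(f has_derivative (\<lambda>(u, v). a * u + b * v)) (at (z\<^sub>1, z\<^sub>2))"
      using D[OF z\<^sub>1 \<open>z\<^sub>2 \<in> T\<close>] by blast
    have "((\<lambda>z. (z\<^sub>1, z)) has_derivative (\<lambda>u. (0, u))) (at z\<^sub>2)"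
      by (intro derivative_intros)
    from has_derivative_compose[OF this ab]
    have "((\<lambda>z\<^sub>2. f (z\<^sub>1, z\<^sub>2)) has_field_derivative b) (at z\<^sub>2)"
      by (simp add: has_field_derivative_def)
    then show "(\<lambda>z\<^sub>2. f (z\<^sub>1, z\<^sub>2)) field_differentiable at z\<^sub>2 within T"
      using field_differentiable_def field_differentiable_at_within by blast
  qed
  show "continuous_on (S \<times> T) f"
    using D by (intro continuous_at_imp_continuous_on ballI) (auto dest: has_derivative_continuous)
qed

lemma nontangential_region_mono:
  "\<kappa> \<le> \<kappa>' \<Longrightarrow> nontangential_region \<alpha> \<kappa> \<zeta> \<subseteq> nontangential_region \<alpha> \<kappa>' \<zeta>"
  unfolding nontangential_region_def
  using mult_right_mono[OF _ infdist_nonneg] by (fastforce intro: less_le_trans)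

text \<open>Translating both coordinates by the same positive real number stays in a fixed product
  of Stolz regions, so it is an admissible non-tangential approach.\<close>

lemma has_nontangential_limit_imp_shift_limit:
  assumes \<alpha>\<^sub>1: "0 < \<alpha>\<^sub>1" "\<alpha>\<^sub>1 < pi / 2" and \<alpha>\<^sub>2: "0 < \<alpha>\<^sub>2" "\<alpha>\<^sub>2 < pi / 2"
    and z: "\<zeta>\<^sub>1 \<in> closed_sector \<alpha>\<^sub>1" "\<zeta>\<^sub>2 \<in> closed_sector \<alpha>\<^sub>2"
    and lim: "has_nontangential_limit \<alpha>\<^sub>1 \<alpha>\<^sub>2 f \<zeta>\<^sub>1 \<zeta>\<^sub>2 L"
  shows "((\<lambda>t. f (\<zeta>\<^sub>1 + of_real t, \<zeta>\<^sub>2 + of_real t)) \<longlongrightarrow> L) (at_right 0)"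
proof -
  \<comment> \<open>Both regions in the definition of the limit share one aperture; the larger of
    the two serves both by monotonicity, and it exceeds 1 because a sine is less than 2.\<close>
  define \<kappa> where "\<kappa> = max (2 / sin \<alpha>\<^sub>1) (2 / sin \<alpha>\<^sub>2)"
  let ?N = "nontangential_region \<alpha>\<^sub>1 \<kappa> \<zeta>\<^sub>1 \<times> nontangential_region \<alpha>\<^sub>2 \<kappa> \<zeta>\<^sub>2"
  have "1 < 2 / sin \<alpha>\<^sub>1"
  proof -
    have "sin \<alpha>\<^sub>1 < 2" using sin_le_one[of \<alpha>\<^sub>1] by linarith
    then show ?thesis using sin_cos_pos(1)[OF \<alpha>\<^sub>1] by (simp add: less_divide_eq)
  qed
  then have "(f \<longlongrightarrow> L) (at (\<zeta>\<^sub>1, \<zeta>\<^sub>2) within ?N)"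
    using lim unfolding has_nontangential_limit_def by (simp add: \<kappa>_def)
  moreover have "filterlim (\<lambda>t. (\<zeta>\<^sub>1 + of_real t, \<zeta>\<^sub>2 + of_real t)) (at (\<zeta>\<^sub>1, \<zeta>\<^sub>2) within ?N) (at_right 0)"
    unfolding filterlim_at
  proof
    have "(\<zeta>\<^sub>1 + of_real t, \<zeta>\<^sub>2 + of_real t) \<in> ?N" if "0 < t" for t
      using shift_in_nontangential_region[OF \<alpha>\<^sub>1 z(1) that] shift_in_nontangential_region[OF \<alpha>\<^sub>2 z(2) that]
        nontangential_region_mono[of "2 / sin \<alpha>\<^sub>1" \<kappa> \<alpha>\<^sub>1 \<zeta>\<^sub>1] nontangential_region_mono[of "2 / sin \<alpha>\<^sub>2" \<kappa> \<alpha>\<^sub>2 \<zeta>\<^sub>2]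
      by (auto simp: \<kappa>_def)
    then show "eventually (\<lambda>t. (\<zeta>\<^sub>1 + of_real t, \<zeta>\<^sub>2 + of_real t) \<in> ?N \<and>
        (\<zeta>\<^sub>1 + of_real t, \<zeta>\<^sub>2 + of_real t) \<noteq> (\<zeta>\<^sub>1, \<zeta>\<^sub>2)) (at_right 0)"
      by (simp add: eventually_at_right_less eventually_at_filter)
    have "((\<lambda>t. (\<zeta>\<^sub>1 + of_real t, \<zeta>\<^sub>2 + of_real t)) \<longlongrightarrow> (\<zeta>\<^sub>1 + of_real 0, \<zeta>\<^sub>2 + of_real 0)) (at_right (0::real))"
      by (intro tendsto_intros)
    then show "((\<lambda>t. (\<zeta>\<^sub>1 + of_real t, \<zeta>\<^sub>2 + of_real t)) \<longlongrightarrow> (\<zeta>\<^sub>1, \<zeta>\<^sub>2)) (at_right (0::real))" by simp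
  qed
  ultimately show ?thesis by (rule filterlim_compose)
qed

text \<open>The product of \<open>f\<close> with the two damping factors is bounded, at most
  \<open>M\<close> far out, and has boundary limits of modulus at most \<open>M\<close>. The maximum
  principle gives the bound \<open>M\<close> inside for every \<delta> > 0, and \<delta> then tends
  to 0.\<close>

lemma sector_indicator_bound:
  fixes f :: "complex \<times> complex \<Rightarrow> complex" and a\<^sub>1 a\<^sub>2 :: complex
  assumes \<alpha>\<^sub>1: "0 < \<alpha>\<^sub>1" "\<alpha>\<^sub>1 < pi / 2" and \<alpha>\<^sub>2: "0 < \<alpha>\<^sub>2" "\<alpha>\<^sub>2 < pi / 2"
    and f: "f \<in> Exp_class \<alpha>\<^sub>1 \<alpha>\<^sub>2" and "0 < M"
    and bdry: "\<And>\<sigma>\<^sub>1 \<sigma>\<^sub>2. \<sigma>\<^sub>1 \<in> {\<alpha>\<^sub>1, - \<alpha>\<^sub>1} \<Longrightarrow> \<sigma>\<^sub>2 \<in> {\<alpha>\<^sub>2, - \<alpha>\<^sub>2} \<Longrightarrow>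
        AE r in (lborel :: (real \<times> real) measure). 0 < fst r \<longrightarrow> 0 < snd r \<longrightarrow>
          (\<exists>L. has_nontangential_limit \<alpha>\<^sub>1 \<alpha>\<^sub>2 f (rcis (fst r) \<sigma>\<^sub>1) (rcis (snd r) \<sigma>\<^sub>2) L \<and>
            norm L \<le> M * exp (Re (a\<^sub>1 * rcis (fst r) \<sigma>\<^sub>1) + Re (a\<^sub>2 * rcis (snd r) \<sigma>\<^sub>2)))"
    and w: "w\<^sub>1 \<in> sector \<alpha>\<^sub>1" "w\<^sub>2 \<in> sector \<alpha>\<^sub>2"
  shows "norm (f (w\<^sub>1, w\<^sub>2)) \<le> M * exp (Re (a\<^sub>1 * w\<^sub>1) + Re (a\<^sub>2 * w\<^sub>2))"
proof -
  \<comment> \<open>Since both angles are below pi/2, an exponent p > 1 with p \<alpha> < pi/2 for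
    both of them exists.\<close>
  have "1 < min (pi / 2 / \<alpha>\<^sub>1) (pi / 2 / \<alpha>\<^sub>2)"
    using \<alpha>\<^sub>1 \<alpha>\<^sub>2 by (simp add: less_divide_eq)
  then obtain p where "1 < p" "p < min (pi / 2 / \<alpha>\<^sub>1) (pi / 2 / \<alpha>\<^sub>2)"
    using dense by blast
  then have p: "1 < p" "0 < p" "p * \<alpha>\<^sub>1 < pi / 2" "p * \<alpha>\<^sub>2 < pi / 2"
    using \<alpha>\<^sub>1 \<alpha>\<^sub>2 by (auto simp: less_divide_eq)
  then have cp: "0 < cos (p * \<alpha>\<^sub>1)" "0 < cos (p * \<alpha>\<^sub>2)"
    using \<alpha>\<^sub>1 \<alpha>\<^sub>2 by (auto intro!: cos_gt_zero mult_pos_pos)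
  obtain h\<^sub>1 h\<^sub>2 where an: "analytic2_on f (sector \<alpha>\<^sub>1 \<times> sector \<alpha>\<^sub>2)" and h: "finite_exp_type \<alpha>\<^sub>1 \<alpha>\<^sub>2 h\<^sub>1 h\<^sub>2 f"
    using f by (auto simp: Exp_class_def)
  then have h0: "0 \<le> h\<^sub>1" "0 \<le> h\<^sub>2" by (auto simp: finite_exp_type_def)
  have "\<exists>k\<ge>0. \<forall>z\<^sub>1\<in>sector \<alpha>\<^sub>1. \<forall>z\<^sub>2\<in>sector \<alpha>\<^sub>2.
      norm (f (z\<^sub>1, z\<^sub>2)) \<le> k * exp ((h\<^sub>1 + 1) * norm z\<^sub>1 + (h\<^sub>2 + 1) * norm z\<^sub>2)"
    using h zero_less_one unfolding finite_exp_type_def by blast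
  then obtain k where "0 \<le> k" and k: "\<And>z\<^sub>1 z\<^sub>2. z\<^sub>1 \<in> sector \<alpha>\<^sub>1 \<Longrightarrow> z\<^sub>2 \<in> sector \<alpha>\<^sub>2 \<Longrightarrow>
      norm (f (z\<^sub>1, z\<^sub>2)) \<le> k * exp ((h\<^sub>1 + 1) * norm z\<^sub>1 + (h\<^sub>2 + 1) * norm z\<^sub>2)"
    by blast
  define F where "F \<delta> z = f z * damping a\<^sub>1 \<delta> p (fst z) * damping a\<^sub>2 \<delta> p (snd z)" for \<delta> z
  have damped: "norm (F \<delta> (w\<^sub>1, w\<^sub>2)) \<le> M" if "0 < \<delta>" for \<delta>
  proof -
    define H\<^sub>1 where "H\<^sub>1 = h\<^sub>1 + 1 + norm a\<^sub>1"
    define H\<^sub>2 where "H\<^sub>2 = h\<^sub>2 + 1 + norm a\<^sub>2"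
    define c\<^sub>1 where "c\<^sub>1 = \<delta> * cos (p * \<alpha>\<^sub>1)"
    define c\<^sub>2 where "c\<^sub>2 = \<delta> * cos (p * \<alpha>\<^sub>2)"
    let ?D\<^sub>1 = "\<lambda>x. exp (H\<^sub>1 * x - c\<^sub>1 * x powr p)" and ?D\<^sub>2 = "\<lambda>x. exp (H\<^sub>2 * x - c\<^sub>2 * x powr p)"
    have pos: "0 < c\<^sub>1" "0 < c\<^sub>2" "0 < H\<^sub>1" "0 < H\<^sub>2"
      using cp h0 \<open>0 < \<delta>\<close> by (auto simp: c\<^sub>1_def c\<^sub>2_def H\<^sub>1_def H\<^sub>2_def intro: add_nonneg_pos add_pos_nonneg)
    obtain B\<^sub>1 where B\<^sub>1: "0 < B\<^sub>1" "\<And>x. 0 \<le> x \<Longrightarrow> ?D\<^sub>1 x \<le> B\<^sub>1"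
        "\<And>\<eta>. 0 < \<eta> \<Longrightarrow> \<exists>R. \<forall>x\<ge>R. ?D\<^sub>1 x \<le> \<eta>"
      by (rule damping_factor_bounds[OF pos(1) p(1) pos(3)]) (rule that)
    obtain B\<^sub>2 where B\<^sub>2: "0 < B\<^sub>2" "\<And>x. 0 \<le> x \<Longrightarrow> ?D\<^sub>2 x \<le> B\<^sub>2"
        "\<And>\<eta>. 0 < \<eta> \<Longrightarrow> \<exists>R. \<forall>x\<ge>R. ?D\<^sub>2 x \<le> \<eta>"
      by (rule damping_factor_bounds[OF pos(2) p(1) pos(4)]) (rule that)
    have bound: "norm (F \<delta> (z\<^sub>1, z\<^sub>2)) \<le> k * (?D\<^sub>1 (norm z\<^sub>1) * ?D\<^sub>2 (norm z\<^sub>2))"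
      if z: "z\<^sub>1 \<in> sector \<alpha>\<^sub>1" "z\<^sub>2 \<in> sector \<alpha>\<^sub>2" for z\<^sub>1 z\<^sub>2
    proof -
      have "norm (F \<delta> (z\<^sub>1, z\<^sub>2)) \<le> (k * exp ((h\<^sub>1 + 1) * norm z\<^sub>1 + (h\<^sub>2 + 1) * norm z\<^sub>2)) *
          exp (norm a\<^sub>1 * norm z\<^sub>1 - c\<^sub>1 * norm z\<^sub>1 powr p) * exp (norm a\<^sub>2 * norm z\<^sub>2 - c\<^sub>2 * norm z\<^sub>2 powr p)"
        unfolding F_def norm_mult c\<^sub>1_def c\<^sub>2_def fst_conv snd_conv
        using z p \<open>0 < \<delta>\<close> \<open>0 \<le> k\<close> by (intro mult_mono k norm_damping_le) auto
      also have "\<dots> = k * (?D\<^sub>1 (norm z\<^sub>1) * ?D\<^sub>2 (norm z\<^sub>2))"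
        unfolding mult.assoc exp_add[symmetric] H\<^sub>1_def H\<^sub>2_def by (simp add: algebra_simps)
      finally show ?thesis .
    qed
    \<comment> \<open>Far out, one damped factor is at most \<eta> and the other at most the larger
      of its bounds, so the total is at most M k/(k + 1). Using k + 1 avoids division by
      zero.\<close>
    define \<eta> where "\<eta> = M / ((k + 1) * max B\<^sub>1 B\<^sub>2)"
    have "0 < \<eta>" using \<open>0 < M\<close> \<open>0 \<le> k\<close> B\<^sub>1(1) by (simp add: \<eta>_def)
    have \<eta>: "k * (\<eta> * max B\<^sub>1 B\<^sub>2) \<le> M"
      using \<open>0 < M\<close> \<open>0 \<le> k\<close> B\<^sub>1(1) by (simp add: \<eta>_def divide_le_eq)
    obtain S\<^sub>1 where S\<^sub>1: "\<And>x. S\<^sub>1 \<le> x \<Longrightarrow> ?D\<^sub>1 x \<le> \<eta>" using B\<^sub>1(3)[OF \<open>0 < \<eta>\<close>] by blast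
    obtain S\<^sub>2 where S\<^sub>2: "\<And>x. S\<^sub>2 \<le> x \<Longrightarrow> ?D\<^sub>2 x \<le> \<eta>" using B\<^sub>2(3)[OF \<open>0 < \<eta>\<close>] by blast
    show ?thesis
    proof (rule polysector_maximum_principle[OF \<alpha>\<^sub>1 \<alpha>\<^sub>2 _ _ _ _ w])
      show "separately_holomorphic_on (F \<delta>) (sector \<alpha>\<^sub>1) (sector \<alpha>\<^sub>2)"
        unfolding F_def using an \<alpha>\<^sub>1 \<alpha>\<^sub>2
        by (intro separately_holomorphic_on_times analytic2_on_imp_separately_holomorphic_on damping_holomorphic_on)
    next
      fix z\<^sub>1 z\<^sub>2 assume z: "z\<^sub>1 \<in> sector \<alpha>\<^sub>1" "z\<^sub>2 \<in> sector \<alpha>\<^sub>2"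
      have "k * (?D\<^sub>1 (norm z\<^sub>1) * ?D\<^sub>2 (norm z\<^sub>2)) \<le> k * (B\<^sub>1 * B\<^sub>2)"
        using B\<^sub>1 B\<^sub>2 \<open>0 \<le> k\<close> by (intro mult_left_mono mult_mono) auto
      with bound[OF z] show "norm (F \<delta> (z\<^sub>1, z\<^sub>2)) \<le> k * (B\<^sub>1 * B\<^sub>2)" by linarith
    next
      fix z\<^sub>1 z\<^sub>2 assume z: "z\<^sub>1 \<in> sector \<alpha>\<^sub>1" "z\<^sub>2 \<in> sector \<alpha>\<^sub>2"
        and R: "max S\<^sub>1 S\<^sub>2 \<le> norm z\<^sub>1 \<or> max S\<^sub>1 S\<^sub>2 \<le> norm z\<^sub>2"
      have "?D\<^sub>1 (norm z\<^sub>1) * ?D\<^sub>2 (norm z\<^sub>2) \<le> \<eta> * max B\<^sub>1 B\<^sub>2"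
      proof (cases "max S\<^sub>1 S\<^sub>2 \<le> norm z\<^sub>1")
        case True
        then show ?thesis
          using S\<^sub>1[of "norm z\<^sub>1"] B\<^sub>2(2)[of "norm z\<^sub>2"] \<open>0 < \<eta>\<close> by (intro mult_mono) auto
      next
        case False
        then have "?D\<^sub>2 (norm z\<^sub>2) * ?D\<^sub>1 (norm z\<^sub>1) \<le> \<eta> * max B\<^sub>1 B\<^sub>2"
          using R S\<^sub>2[of "norm z\<^sub>2"] B\<^sub>1(2)[of "norm z\<^sub>1"] \<open>0 < \<eta>\<close> by (intro mult_mono) auto
        then show ?thesis by (simp add: mult.commute)
      qed
      then have "k * (?D\<^sub>1 (norm z\<^sub>1) * ?D\<^sub>2 (norm z\<^sub>2)) \<le> k * (\<eta> * max B\<^sub>1 B\<^sub>2)"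
        using \<open>0 \<le> k\<close> by (rule mult_left_mono)
      with bound[OF z] \<eta> show "norm (F \<delta> (z\<^sub>1, z\<^sub>2)) \<le> M" by linarith
    next
      fix \<sigma>\<^sub>1 \<sigma>\<^sub>2 assume \<sigma>: "\<sigma>\<^sub>1 \<in> {\<alpha>\<^sub>1, - \<alpha>\<^sub>1}" "\<sigma>\<^sub>2 \<in> {\<alpha>\<^sub>2, - \<alpha>\<^sub>2}"
      then have abs_\<sigma>: "\<bar>\<sigma>\<^sub>1\<bar> \<le> \<alpha>\<^sub>1" "\<bar>\<sigma>\<^sub>2\<bar> \<le> \<alpha>\<^sub>2" "\<bar>\<sigma>\<^sub>1\<bar> < pi / 2" "\<bar>\<sigma>\<^sub>2\<bar> < pi / 2"
        using \<alpha>\<^sub>1 \<alpha>\<^sub>2 by auto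
      from bdry[OF \<sigma>] show "AE r in (lborel :: (real \<times> real) measure). 0 < fst r \<longrightarrow> 0 < snd r \<longrightarrow>
          (\<exists>L. norm L \<le> M \<and>
            ((\<lambda>t. F \<delta> (rcis (fst r) \<sigma>\<^sub>1 + of_real t, rcis (snd r) \<sigma>\<^sub>2 + of_real t)) \<longlongrightarrow> L) (at_right 0))"
      proof (eventually_elim, intro impI)
        fix r :: "real \<times> real"
        let ?\<zeta>\<^sub>1 = "rcis (fst r) \<sigma>\<^sub>1" and ?\<zeta>\<^sub>2 = "rcis (snd r) \<sigma>\<^sub>2"
        assume r: "0 < fst r" "0 < snd r" and "0 < fst r \<longrightarrow> 0 < snd r \<longrightarrow>
          (\<exists>L. has_nontangential_limit \<alpha>\<^sub>1 \<alpha>\<^sub>2 f ?\<zeta>\<^sub>1 ?\<zeta>\<^sub>2 L \<and>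
            norm L \<le> M * exp (Re (a\<^sub>1 * ?\<zeta>\<^sub>1) + Re (a\<^sub>2 * ?\<zeta>\<^sub>2)))"
        then obtain L where L: "has_nontangential_limit \<alpha>\<^sub>1 \<alpha>\<^sub>2 f ?\<zeta>\<^sub>1 ?\<zeta>\<^sub>2 L"
            "norm L \<le> M * exp (Re (a\<^sub>1 * ?\<zeta>\<^sub>1) + Re (a\<^sub>2 * ?\<zeta>\<^sub>2))" by blast
        \<comment> \<open>The boundary rays lie in the right half-plane, away from the branch cut,
          so the damping factors are continuous there and the limit of the product is the product of
          the limits.\<close>
        have Re: "0 < Re ?\<zeta>\<^sub>1" "0 < Re ?\<zeta>\<^sub>2"
          using r abs_\<sigma> by (auto intro!: mult_pos_pos cos_gt_zero_pi)
        let ?L = "L * damping a\<^sub>1 \<delta> p ?\<zeta>\<^sub>1 * damping a\<^sub>2 \<delta> p ?\<zeta>\<^sub>2"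
        have d: "((\<lambda>t. damping a \<delta> p (\<zeta> + of_real t)) \<longlongrightarrow> damping a \<delta> p \<zeta>) (at_right (0::real))"
          if "0 < Re \<zeta>" for a \<zeta>
        proof -
          have "((\<lambda>t. \<zeta> + of_real t) \<longlongrightarrow> \<zeta> + of_real 0) (at_right (0::real))"
            by (intro tendsto_intros)
          then show ?thesis
            using isCont_tendsto_compose[OF isCont_damping[OF that]] by simp
        qed
        have "((\<lambda>t. f (?\<zeta>\<^sub>1 + of_real t, ?\<zeta>\<^sub>2 + of_real t)) \<longlongrightarrow> L) (at_right 0)"
          using r abs_\<sigma> L(1)
          by (intro has_nontangential_limit_imp_shift_limit[OF \<alpha>\<^sub>1 \<alpha>\<^sub>2] rcis_in_closed_sector \<alpha>\<^sub>1 \<alpha>\<^sub>2) auto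
        then have "((\<lambda>t. F \<delta> (?\<zeta>\<^sub>1 + of_real t, ?\<zeta>\<^sub>2 + of_real t)) \<longlongrightarrow> ?L) (at_right 0)"
          unfolding F_def fst_conv snd_conv by (intro tendsto_mult d Re)
        moreover have "norm ?L \<le> M"
        proof -
          have "norm ?L \<le> (M * exp (Re (a\<^sub>1 * ?\<zeta>\<^sub>1) + Re (a\<^sub>2 * ?\<zeta>\<^sub>2))) *
              exp (- Re (a\<^sub>1 * ?\<zeta>\<^sub>1)) * exp (- Re (a\<^sub>2 * ?\<zeta>\<^sub>2))"
            unfolding norm_mult using L(2) \<open>0 < M\<close> r abs_\<sigma> \<alpha>\<^sub>1 \<alpha>\<^sub>2 p \<open>0 < \<delta>\<close>
            by (intro mult_mono norm_damping_boundary_le[of _ _ \<alpha>\<^sub>1] norm_damping_boundary_le[of _ _ \<alpha>\<^sub>2]) auto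
          also have "\<dots> = M"
            unfolding mult.assoc exp_add[symmetric] by simp
          finally show ?thesis .
        qed
        ultimately show "\<exists>L. norm L \<le> M \<and>
            ((\<lambda>t. F \<delta> (?\<zeta>\<^sub>1 + of_real t, ?\<zeta>\<^sub>2 + of_real t)) \<longlongrightarrow> L) (at_right 0)"
          by blast
      qed
    qed
  qed
  have "((\<lambda>\<delta>. norm (F \<delta> (w\<^sub>1, w\<^sub>2))) \<longlongrightarrow> norm (F 0 (w\<^sub>1, w\<^sub>2))) (at_right 0)"
    unfolding F_def damping_def by (intro tendsto_intros)
  moreover have "eventually (\<lambda>\<delta>. norm (F \<delta> (w\<^sub>1, w\<^sub>2)) \<le> M) (at_right 0)"
    using damped by (simp add: eventually_at_right_less eventually_at_filter)
  ultimately have "norm (F 0 (w\<^sub>1, w\<^sub>2)) \<le> M"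
    by (rule tendsto_upperbound) simp
  moreover define s where "s = Re (a\<^sub>1 * w\<^sub>1) + Re (a\<^sub>2 * w\<^sub>2)"
  ultimately have "norm (f (w\<^sub>1, w\<^sub>2)) * exp (- s) \<le> M"
    by (simp add: F_def norm_mult norm_damping mult.assoc flip: exp_add)
  then have "norm (f (w\<^sub>1, w\<^sub>2)) \<le> M * exp s"
    by (simp add: exp_minus field_simps)
  then show ?thesis
    by (simp only: s_def)
qed

section \<open>Indicator sets, interpolation of slopes and the conclusion\<close>

lemma ln_norm_le_iff: "ln_norm w \<le> ereal x \<longleftrightarrow> norm w \<le> exp x"
proof (cases "w = 0")
  case False
  then have "norm w \<le> exp x \<longleftrightarrow> exp (ln (norm w)) \<le> exp x"
    by simp
  with False show ?thesis
    unfolding exp_le_cancel_iff by (simp add: ln_norm_def)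
qed (simp add: ln_norm_def)

text \<open>Some element of the indicator set lies within \<epsilon> of the given point in each
  coordinate. The radii are positive, so raising its slopes to those of the point plus \<epsilon>
  only weakens the bound.\<close>

lemma closure_indicator_setD:
  assumes A: "(A\<^sub>1, A\<^sub>2) \<in> closure (indicator_set \<alpha>\<^sub>1 \<alpha>\<^sub>2 f \<sigma>\<^sub>1 \<sigma>\<^sub>2)" and \<sigma>: "\<not> (\<bar>\<sigma>\<^sub>1\<bar> < \<alpha>\<^sub>1 \<and> \<bar>\<sigma>\<^sub>2\<bar> < \<alpha>\<^sub>2)"
    and "0 < \<epsilon>"
  obtains C where "AE r in (lborel :: (real \<times> real) measure). 0 < fst r \<longrightarrow> 0 < snd r \<longrightarrow>
      (\<exists>L. has_nontangential_limit \<alpha>\<^sub>1 \<alpha>\<^sub>2 f (rcis (fst r) \<sigma>\<^sub>1) (rcis (snd r) \<sigma>\<^sub>2) L \<and>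
        norm L \<le> exp ((A\<^sub>1 + \<epsilon>) * fst r + (A\<^sub>2 + \<epsilon>) * snd r + C))"
proof -
  obtain \<nu>\<^sub>1 \<nu>\<^sub>2 where \<nu>: "(\<nu>\<^sub>1, \<nu>\<^sub>2) \<in> indicator_set \<alpha>\<^sub>1 \<alpha>\<^sub>2 f \<sigma>\<^sub>1 \<sigma>\<^sub>2" and d: "dist (\<nu>\<^sub>1, \<nu>\<^sub>2) (A\<^sub>1, A\<^sub>2) < \<epsilon>"
    using A \<open>0 < \<epsilon>\<close> unfolding closure_approachable by (metis surj_pair)
  have le: "\<nu>\<^sub>1 \<le> A\<^sub>1 + \<epsilon>" "\<nu>\<^sub>2 \<le> A\<^sub>2 + \<epsilon>"
    using d dist_fst_le[of "(\<nu>\<^sub>1, \<nu>\<^sub>2)" "(A\<^sub>1, A\<^sub>2)"] dist_snd_le[of "(\<nu>\<^sub>1, \<nu>\<^sub>2)" "(A\<^sub>1, A\<^sub>2)"]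
    by (auto simp: dist_real_def abs_if split: if_splits)
  from \<nu> \<sigma> obtain C where C: "AE r in (lborel :: (real \<times> real) measure). 0 < fst r \<longrightarrow> 0 < snd r \<longrightarrow>
      (\<exists>L. has_nontangential_limit \<alpha>\<^sub>1 \<alpha>\<^sub>2 f (rcis (fst r) \<sigma>\<^sub>1) (rcis (snd r) \<sigma>\<^sub>2) L \<and>
        norm L \<le> exp (\<nu>\<^sub>1 * fst r + \<nu>\<^sub>2 * snd r + C))"
    unfolding indicator_set_def ln_norm_le_iff by (auto split: if_splits)
  show thesis
  proof (rule that[of C])
    from C show "AE r in (lborel :: (real \<times> real) measure). 0 < fst r \<longrightarrow> 0 < snd r \<longrightarrow>
      (\<exists>L. has_nontangential_limit \<alpha>\<^sub>1 \<alpha>\<^sub>2 f (rcis (fst r) \<sigma>\<^sub>1) (rcis (snd r) \<sigma>\<^sub>2) L \<and>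
        norm L \<le> exp ((A\<^sub>1 + \<epsilon>) * fst r + (A\<^sub>2 + \<epsilon>) * snd r + C))"
    proof (eventually_elim, intro impI)
      fix r :: "real \<times> real"
      assume r: "0 < fst r" "0 < snd r" and "0 < fst r \<longrightarrow> 0 < snd r \<longrightarrow>
        (\<exists>L. has_nontangential_limit \<alpha>\<^sub>1 \<alpha>\<^sub>2 f (rcis (fst r) \<sigma>\<^sub>1) (rcis (snd r) \<sigma>\<^sub>2) L \<and>
          norm L \<le> exp (\<nu>\<^sub>1 * fst r + \<nu>\<^sub>2 * snd r + C))"
      moreover have "exp (\<nu>\<^sub>1 * fst r + \<nu>\<^sub>2 * snd r + C) \<le> exp ((A\<^sub>1 + \<epsilon>) * fst r + (A\<^sub>2 + \<epsilon>) * snd r + C)"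
        using le r by (auto intro!: add_mono mult_right_mono)
      ultimately show "\<exists>L. has_nontangential_limit \<alpha>\<^sub>1 \<alpha>\<^sub>2 f (rcis (fst r) \<sigma>\<^sub>1) (rcis (snd r) \<sigma>\<^sub>2) L \<and>
          norm L \<le> exp ((A\<^sub>1 + \<epsilon>) * fst r + (A\<^sub>2 + \<epsilon>) * snd r + C)"
        by (meson order_trans)
    qed
  qed
qed

text \<open>For fixed \<open>a\<close>, the slope of the real part of \<open>a * z\<close> along the
  ray of angle \<phi> is a combination of cos \<phi> and sin \<phi>. The values at \<alpha> and
  -\<alpha> determine it, and the relation for \<open>D\<close> is its value at \<theta>.\<close>

lemma trigonometric_interpolation:
  fixes \<alpha> \<theta> X Y D :: real
  assumes \<alpha>: "0 < \<alpha>" "\<alpha> < pi / 2" and D: "D * sin (2 * \<alpha>) = X * sin (\<theta> + \<alpha>) + Y * sin (\<alpha> - \<theta>)"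
  obtains a where "\<And>r. Re (a * rcis r \<alpha>) = X * r" "\<And>r. Re (a * rcis r (- \<alpha>)) = Y * r"
    "\<And>r. Re (a * rcis r \<theta>) = D * r"
proof
  note pos = sin_cos_pos[OF \<alpha>]
  \<comment> \<open>The even part of the slope function is fitted by half the sum of
    \<open>X\<close> and \<open>Y\<close>, the odd part by half their difference.\<close>
  let ?a = "Complex ((X + Y) / (2 * cos \<alpha>)) (- (X - Y) / (2 * sin \<alpha>))"
  have Re: "Re (?a * rcis r \<phi>) = ((X + Y) / (2 * cos \<alpha>) * cos \<phi> + (X - Y) / (2 * sin \<alpha>) * sin \<phi>) * r" for r \<phi>
    by (simp add: algebra_simps diff_divide_distrib)
  show "Re (?a * rcis r \<alpha>) = X * r" "Re (?a * rcis r (- \<alpha>)) = Y * r" for r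
    unfolding Re using pos by (simp_all add: field_simps)
  have "(X + Y) / (2 * cos \<alpha>) * cos \<theta> + (X - Y) / (2 * sin \<alpha>) * sin \<theta> =
      (X * sin (\<theta> + \<alpha>) + Y * sin (\<alpha> - \<theta>)) / sin (2 * \<alpha>)"
    unfolding sin_double sin_add sin_diff using pos by (simp add: field_simps)
  also have "\<dots> = D"
    using pos by (simp add: D[symmetric] sin_double)
  finally show "Re (?a * rcis r \<theta>) = D * r" for r
    unfolding Re by simp
qed

theorem theorem1p1p5:
  fixes \<alpha>\<^sub>1 \<alpha>\<^sub>2 \<theta>\<^sub>1 \<theta>\<^sub>2 A\<^sub>1p A\<^sub>2p A\<^sub>1m A\<^sub>2m C\<^sub>1 C\<^sub>2 :: real
    and f :: "complex \<times> complex \<Rightarrow> complex"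
  assumes "0 < \<alpha>\<^sub>1" "\<alpha>\<^sub>1 < pi / 2" "0 < \<alpha>\<^sub>2" "\<alpha>\<^sub>2 < pi / 2"
    and "f \<in> Exp_class \<alpha>\<^sub>1 \<alpha>\<^sub>2"
    and "(A\<^sub>1p, A\<^sub>2p) \<in> closure (indicator_set \<alpha>\<^sub>1 \<alpha>\<^sub>2 f \<alpha>\<^sub>1 \<alpha>\<^sub>2)"
    and "(A\<^sub>1m, A\<^sub>2m) \<in> closure (indicator_set \<alpha>\<^sub>1 \<alpha>\<^sub>2 f (- \<alpha>\<^sub>1) (- \<alpha>\<^sub>2))"
    and "(A\<^sub>1p, A\<^sub>2m) \<in> closure (indicator_set \<alpha>\<^sub>1 \<alpha>\<^sub>2 f \<alpha>\<^sub>1 (- \<alpha>\<^sub>2))"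
    and "(A\<^sub>1m, A\<^sub>2p) \<in> closure (indicator_set \<alpha>\<^sub>1 \<alpha>\<^sub>2 f (- \<alpha>\<^sub>1) \<alpha>\<^sub>2)"
    and "\<bar>\<theta>\<^sub>1\<bar> < \<alpha>\<^sub>1" "\<bar>\<theta>\<^sub>2\<bar> < \<alpha>\<^sub>2"
    and "C\<^sub>1 * sin (2 * \<alpha>\<^sub>1) = A\<^sub>1p * sin (\<theta>\<^sub>1 + \<alpha>\<^sub>1) + A\<^sub>1m * sin (\<alpha>\<^sub>1 - \<theta>\<^sub>1)"
    and "C\<^sub>2 * sin (2 * \<alpha>\<^sub>2) = A\<^sub>2p * sin (\<theta>\<^sub>2 + \<alpha>\<^sub>2) + A\<^sub>2m * sin (\<alpha>\<^sub>2 - \<theta>\<^sub>2)"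
  shows "(C\<^sub>1, C\<^sub>2) \<in> closure (indicator_set \<alpha>\<^sub>1 \<alpha>\<^sub>2 f \<theta>\<^sub>1 \<theta>\<^sub>2)"
proof -
  note \<alpha>\<^sub>1 = assms(1,2) and \<alpha>\<^sub>2 = assms(3,4)
  \<comment> \<open>This is the value at the inner angle of the sinusoid that equals 1 on both
    boundary rays. Raising both boundary slopes by \<epsilon> therefore raises the interpolated
    slope by this multiple of \<epsilon>.\<close>
  define q\<^sub>1 where "q\<^sub>1 = (sin (\<theta>\<^sub>1 + \<alpha>\<^sub>1) + sin (\<alpha>\<^sub>1 - \<theta>\<^sub>1)) / sin (2 * \<alpha>\<^sub>1)"
  define q\<^sub>2 where "q\<^sub>2 = (sin (\<theta>\<^sub>2 + \<alpha>\<^sub>2) + sin (\<alpha>\<^sub>2 - \<theta>\<^sub>2)) / sin (2 * \<alpha>\<^sub>2)"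
  have q: "q\<^sub>1 * sin (2 * \<alpha>\<^sub>1) = sin (\<theta>\<^sub>1 + \<alpha>\<^sub>1) + sin (\<alpha>\<^sub>1 - \<theta>\<^sub>1)"
    "q\<^sub>2 * sin (2 * \<alpha>\<^sub>2) = sin (\<theta>\<^sub>2 + \<alpha>\<^sub>2) + sin (\<alpha>\<^sub>2 - \<theta>\<^sub>2)"
    using sin_cos_pos[OF \<alpha>\<^sub>1] sin_cos_pos[OF \<alpha>\<^sub>2] by (simp_all add: q\<^sub>1_def q\<^sub>2_def sin_double)
  have mem: "(C\<^sub>1 + q\<^sub>1 * \<epsilon>, C\<^sub>2 + q\<^sub>2 * \<epsilon>) \<in> indicator_set \<alpha>\<^sub>1 \<alpha>\<^sub>2 f \<theta>\<^sub>1 \<theta>\<^sub>2" if "0 < \<epsilon>" for \<epsilon>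
  proof -
    have "(C\<^sub>1 + q\<^sub>1 * \<epsilon>) * sin (2 * \<alpha>\<^sub>1) =
        C\<^sub>1 * sin (2 * \<alpha>\<^sub>1) + (q\<^sub>1 * sin (2 * \<alpha>\<^sub>1)) * \<epsilon>" by (simp add: algebra_simps)
    also have "\<dots> = (A\<^sub>1p + \<epsilon>) * sin (\<theta>\<^sub>1 + \<alpha>\<^sub>1) + (A\<^sub>1m + \<epsilon>) * sin (\<alpha>\<^sub>1 - \<theta>\<^sub>1)"
      unfolding q assms(12) by (simp add: distrib_right distrib_left)
    finally obtain a\<^sub>1 where a\<^sub>1: "\<And>r. Re (a\<^sub>1 * rcis r \<alpha>\<^sub>1) = (A\<^sub>1p + \<epsilon>) * r"
        "\<And>r. Re (a\<^sub>1 * rcis r (- \<alpha>\<^sub>1)) = (A\<^sub>1m + \<epsilon>) * r" "\<And>r. Re (a\<^sub>1 * rcis r \<theta>\<^sub>1) = (C\<^sub>1 + q\<^sub>1 * \<epsilon>) * r"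
      by (rule trigonometric_interpolation[OF \<alpha>\<^sub>1]) (rule that)
    have "(C\<^sub>2 + q\<^sub>2 * \<epsilon>) * sin (2 * \<alpha>\<^sub>2) =
        C\<^sub>2 * sin (2 * \<alpha>\<^sub>2) + (q\<^sub>2 * sin (2 * \<alpha>\<^sub>2)) * \<epsilon>" by (simp add: algebra_simps)
    also have "\<dots> = (A\<^sub>2p + \<epsilon>) * sin (\<theta>\<^sub>2 + \<alpha>\<^sub>2) + (A\<^sub>2m + \<epsilon>) * sin (\<alpha>\<^sub>2 - \<theta>\<^sub>2)"
      unfolding q assms(13) by (simp add: distrib_right distrib_left)
    finally obtain a\<^sub>2 where a\<^sub>2: "\<And>r. Re (a\<^sub>2 * rcis r \<alpha>\<^sub>2) = (A\<^sub>2p + \<epsilon>) * r"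
        "\<And>r. Re (a\<^sub>2 * rcis r (- \<alpha>\<^sub>2)) = (A\<^sub>2m + \<epsilon>) * r" "\<And>r. Re (a\<^sub>2 * rcis r \<theta>\<^sub>2) = (C\<^sub>2 + q\<^sub>2 * \<epsilon>) * r"
      by (rule trigonometric_interpolation[OF \<alpha>\<^sub>2]) (rule that)
    \<comment> \<open>The boundary hypothesis of \<open>sector_indicator_bound\<close> with
      \<open>exp C\<close> in the role of \<open>M\<close>. The same \<open>a\<^sub>1\<close> and
      \<open>a\<^sub>2\<close> serve all four pairs of rays, because the slope prescribed in each
      variable depends only on the ray chosen in that variable.\<close>
    define P where "P C \<sigma>\<^sub>1 \<sigma>\<^sub>2 \<longleftrightarrow> (AE r in (lborel :: (real \<times> real) measure). 0 < fst r \<longrightarrow> 0 < snd r \<longrightarrow>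
        (\<exists>L. has_nontangential_limit \<alpha>\<^sub>1 \<alpha>\<^sub>2 f (rcis (fst r) \<sigma>\<^sub>1) (rcis (snd r) \<sigma>\<^sub>2) L \<and>
          norm L \<le> exp C * exp (Re (a\<^sub>1 * rcis (fst r) \<sigma>\<^sub>1) + Re (a\<^sub>2 * rcis (snd r) \<sigma>\<^sub>2))))" for C \<sigma>\<^sub>1 \<sigma>\<^sub>2
    have P_mono: "P C' \<sigma>\<^sub>1 \<sigma>\<^sub>2" if "P C \<sigma>\<^sub>1 \<sigma>\<^sub>2" "C \<le> C'" for C C' \<sigma>\<^sub>1 \<sigma>\<^sub>2
    proof -
      have le: "exp C * exp y \<le> exp C' * exp y" for y :: real
        using \<open>C \<le> C'\<close> by (intro mult_right_mono) auto
      show ?thesis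
        using \<open>P C \<sigma>\<^sub>1 \<sigma>\<^sub>2\<close> unfolding P_def by eventually_elim (meson le order_trans)
    qed
    have P: "\<exists>C. P C \<sigma>\<^sub>1 \<sigma>\<^sub>2" if A: "(A\<^sub>1, A\<^sub>2) \<in> closure (indicator_set \<alpha>\<^sub>1 \<alpha>\<^sub>2 f \<sigma>\<^sub>1 \<sigma>\<^sub>2)"
      and \<sigma>: "\<bar>\<sigma>\<^sub>1\<bar> = \<alpha>\<^sub>1"
      and a: "\<And>r. Re (a\<^sub>1 * rcis r \<sigma>\<^sub>1) = (A\<^sub>1 + \<epsilon>) * r" "\<And>r. Re (a\<^sub>2 * rcis r \<sigma>\<^sub>2) = (A\<^sub>2 + \<epsilon>) * r"
      for A\<^sub>1 A\<^sub>2 \<sigma>\<^sub>1 \<sigma>\<^sub>2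
    proof -
      have *: "\<not> (\<bar>\<sigma>\<^sub>1\<bar> < \<alpha>\<^sub>1 \<and> \<bar>\<sigma>\<^sub>2\<bar> < \<alpha>\<^sub>2)"
        using \<sigma> by simp
      obtain C where C: "AE r in (lborel :: (real \<times> real) measure). 0 < fst r \<longrightarrow> 0 < snd r \<longrightarrow>
          (\<exists>L. has_nontangential_limit \<alpha>\<^sub>1 \<alpha>\<^sub>2 f (rcis (fst r) \<sigma>\<^sub>1) (rcis (snd r) \<sigma>\<^sub>2) L \<and>
            norm L \<le> exp ((A\<^sub>1 + \<epsilon>) * fst r + (A\<^sub>2 + \<epsilon>) * snd r + C))"
        by (rule closure_indicator_setD[OF A * \<open>0 < \<epsilon>\<close>])
      have "P C \<sigma>\<^sub>1 \<sigma>\<^sub>2"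
        unfolding P_def a exp_add[symmetric] add.commute[of C] by (rule C)
      then show ?thesis ..
    qed
    obtain K\<^sub>1 where K\<^sub>1: "P K\<^sub>1 \<alpha>\<^sub>1 \<alpha>\<^sub>2"
      using P[OF assms(6) _ a\<^sub>1(1) a\<^sub>2(1)] \<alpha>\<^sub>1 by auto
    obtain K\<^sub>2 where K\<^sub>2: "P K\<^sub>2 (- \<alpha>\<^sub>1) (- \<alpha>\<^sub>2)"
      using P[OF assms(7) _ a\<^sub>1(2) a\<^sub>2(2)] \<alpha>\<^sub>1 by auto
    obtain K\<^sub>3 where K\<^sub>3: "P K\<^sub>3 \<alpha>\<^sub>1 (- \<alpha>\<^sub>2)"
      using P[OF assms(8) _ a\<^sub>1(1) a\<^sub>2(2)] \<alpha>\<^sub>1 by auto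
    obtain K\<^sub>4 where K\<^sub>4: "P K\<^sub>4 (- \<alpha>\<^sub>1) \<alpha>\<^sub>2"
      using P[OF assms(9) _ a\<^sub>1(2) a\<^sub>2(1)] \<alpha>\<^sub>1 by auto
    \<comment> \<open>One constant that works on all four pairs of boundary rays.\<close>
    define C where "C = max (max K\<^sub>1 K\<^sub>2) (max K\<^sub>3 K\<^sub>4)"
    have C: "P C \<sigma>\<^sub>1 \<sigma>\<^sub>2" if "\<sigma>\<^sub>1 \<in> {\<alpha>\<^sub>1, - \<alpha>\<^sub>1}" "\<sigma>\<^sub>2 \<in> {\<alpha>\<^sub>2, - \<alpha>\<^sub>2}" for \<sigma>\<^sub>1 \<sigma>\<^sub>2
      using that P_mono[OF K\<^sub>1, of C] P_mono[OF K\<^sub>2, of C] P_mono[OF K\<^sub>3, of C] P_mono[OF K\<^sub>4, of C]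
      by (auto simp: C_def)
    have "norm (f (rcis r\<^sub>1 \<theta>\<^sub>1, rcis r\<^sub>2 \<theta>\<^sub>2)) \<le> exp ((C\<^sub>1 + q\<^sub>1 * \<epsilon>) * r\<^sub>1 + (C\<^sub>2 + q\<^sub>2 * \<epsilon>) * r\<^sub>2 + C)"
      if "0 < r\<^sub>1" "0 < r\<^sub>2" for r\<^sub>1 r\<^sub>2
    proof -
      have "norm (f (rcis r\<^sub>1 \<theta>\<^sub>1, rcis r\<^sub>2 \<theta>\<^sub>2)) \<le>
          exp C * exp (Re (a\<^sub>1 * rcis r\<^sub>1 \<theta>\<^sub>1) + Re (a\<^sub>2 * rcis r\<^sub>2 \<theta>\<^sub>2))"
        by (rule sector_indicator_bound[OF \<alpha>\<^sub>1 \<alpha>\<^sub>2 assms(5) _ C[unfolded P_def]])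
          (use that assms(10,11) in \<open>auto intro!: rcis_in_sector \<alpha>\<^sub>1 \<alpha>\<^sub>2\<close>)
      then show ?thesis
        unfolding a\<^sub>1(3) a\<^sub>2(3) exp_add[symmetric] add.commute[of C] .
    qed
    then show ?thesis
      using assms(10,11) by (auto simp: indicator_set_def ln_norm_le_iff)
  qed
  \<comment> \<open>The perturbed points belong to the indicator set and converge to the required
    point as \<epsilon> decreases to 0; this is where the closure in the conclusion is used.\<close>
  have "((\<lambda>\<epsilon>. (C\<^sub>1 + q\<^sub>1 * \<epsilon>, C\<^sub>2 + q\<^sub>2 * \<epsilon>)) \<longlongrightarrow> (C\<^sub>1 + q\<^sub>1 * 0, C\<^sub>2 + q\<^sub>2 * 0)) (at_right 0)"
    by (intro tendsto_intros)
  then have lim: "((\<lambda>\<epsilon>. (C\<^sub>1 + q\<^sub>1 * \<epsilon>, C\<^sub>2 + q\<^sub>2 * \<epsilon>)) \<longlongrightarrow> (C\<^sub>1, C\<^sub>2)) (at_right 0)"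
    by simp
  have "eventually (\<lambda>\<epsilon>. (C\<^sub>1 + q\<^sub>1 * \<epsilon>, C\<^sub>2 + q\<^sub>2 * \<epsilon>) \<in> closure (indicator_set \<alpha>\<^sub>1 \<alpha>\<^sub>2 f \<theta>\<^sub>1 \<theta>\<^sub>2)) (at_right 0)"
    using eventually_at_right_less[of 0] by eventually_elim (rule subsetD[OF closure_subset mem])
  with closed_closure show ?thesis
    by (rule Lim_in_closed_set) (use lim in auto)
qed

end
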